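(* Let $\mathcal{D}(A^2)=\{f\in\mathcal{D}(A)\mid Af\in\mathcal{D}(A)\}$ be the domain of the square of the Legendre polynomials operator $A$ in $L^2(-1,1)$, and let $\mathcal{D}(S)$ be the set of all $f:(-1,1)\to\mathbb{C}$ such that $f,f',f'',f'''\in AC_{\mathrm{loc}}(-1,1)$, $f,\ell^2[f]\in L^2(-1,1)$, $\lim_{x\to\pm1}[f,1]_2(x)=0$ and $\lim_{x\to\pm1}[f,x]_2(x)=0$. Then $$\mathcal{D}(A^2)=\mathcal{D}(S).$$
   Context: $AC_{\mathrm{loc}}(-1,1)$ denotes the complex-valued functions on $(-1,1)$ that are absolutely continuous on every compact subinterval. The Legendre expression is $\ell[y](x)=-\left((1-x^2)y'(x)\right)'$, defined for a.e. $x\in(-1,1)$. The Legendre polynomials operator $A$ in $L^2(-1,1)$ is $Af=\ell[f]$ with domain $$\mathcal{D}(A)=\{f:(-1,1)\to\mathbb{C}\mid f,f'\in AC_{\mathrm{loc}}(-1,1);\ f,\ell[f]\in L^2(-1,1);\ \lim_{x\to\pm1}(1-x^2)f'(x)=0\}.$$ (Here $Af$ is an element of $L^2(-1,1)$; "$Af\in\mathcal{D}(A)$" is understood up to a.e. equality.) The square of the Legendre expression is $$\ell^2[y](x)=\left((1-x^2)^2y''(x)\right)''-2\left((1-x^2)y'(x)\right)' .$$ The associated sesquilinear form $[f,g]_2$, for $f,g$ with $f^{(j)},g^{(j)}\in AC_{\mathrm{loc}}(-1,1)$ ($j=0,1,2,3$) and $f,\ell^2[f],g,\ell^2[g]\in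 L^2(-1,1)$, is $$[f,g]_2(x)=\left((1-x^2)^2f''\right)'\overline{g}-\left((1-x^2)^2\overline{g}''\right)'f-(1-x^2)^2f''\overline{g}'+(1-x^2)^2f'\overline{g}''-2(1-x^2)f'\overline{g}+2(1-x^2)f\overline{g}',$$ all functions evaluated at $x\in(-1,1)$. In $[f,1]_2$ and $[f,x]_2$ the second argument is the constant function $1$, respectively the identity function $x\mapsto x$; thus $[f,1]_2(x)=\left((1-x^2)^2f''(x)\right)'-2(1-x^2)f'(x)$ and $[f,x]_2(x)=x[f,1]_2(x)-(1-x^2)^2f''(x)+2(1-x^2)f(x)$. A limit "$x\to\pm1$" means both one-sided limits, $x\to1^-$ and $x\to-1^+$. *)

theory Defs
  imports "HOL-Analysis.Analysis"
begin

abbreviation Iop :: "real set" where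
  "Iop \<equiv> {-1<..<1}"

definition abs_cont_on :: "real \<Rightarrow> real \<Rightarrow> (real \<Rightarrow> complex) \<Rightarrow> bool" where
  "abs_cont_on a b f \<longleftrightarrow>
     (\<forall>\<epsilon>>0. \<exists>\<delta>>0. \<forall>(n::nat) u v.
        (\<forall>i<n. a \<le> u i \<and> u i \<le> v i \<and> v i \<le> b) \<and>
        disjoint_family_on (\<lambda>i. {u i<..<v i}) {..<n} \<and>
        (\<Sum>i<n. v i - u i) < \<delta>
        \<longrightarrow> (\<Sum>i<n. norm (f (v i) - f (u i))) < \<epsilon>)"

definition AC_loc :: "(real \<Rightarrow> complex) set" where
  "AC_loc = {f. \<forall>a b. -1 < a \<and> a \<le> b \<and> b < 1 \<longrightarrow> abs_cont_on a b f}"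

definition D :: "(real \<Rightarrow> complex) \<Rightarrow> real \<Rightarrow> complex" where
  "D f = (\<lambda>x. vector_derivative f (at x))"

text \<open>\<open>AC_loc_upto n\<close> says that \<open>f, f', \<dots>, f\<^sup>(\<^sup>n\<^sup>)\<close> all exist on the whole interval and
  lie in \<open>AC_loc\<close>. The differentiability clause is needed because
  \<^const>\<open>vector_derivative\<close> is total.\<close>

definition AC_loc_upto :: "nat \<Rightarrow> (real \<Rightarrow> complex) set" where
  "AC_loc_upto n = {f. (\<forall>j<n. \<forall>x\<in>Iop. (D ^^ j) f differentiable (at x)) \<and>
                       (\<forall>j\<le>n. (D ^^ j) f \<in> AC_loc)}"

text \<open>Lebesgue (completed) measure is used since the elements below are only defined almost
  everywhere: an absolutely continuous function is differentiable off a null set, and the values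
  of \<^const>\<open>D\<close> on that null set are immaterial.\<close>

definition L2 :: "(real \<Rightarrow> complex) set" where
  "L2 = {f. f \<in> borel_measurable (lebesgue_on Iop) \<and>
            integrable (lebesgue_on Iop) (\<lambda>x. (norm (f x))\<^sup>2)}"

definition lim_ends_zero :: "(real \<Rightarrow> complex) \<Rightarrow> bool" where
  "lim_ends_zero h \<longleftrightarrow> (h \<longlongrightarrow> 0) (at_left 1) \<and> (h \<longlongrightarrow> 0) (at_right (-1))"

definition legendre :: "(real \<Rightarrow> complex) \<Rightarrow> real \<Rightarrow> complex" where
  "legendre y = (\<lambda>x. - D (\<lambda>t. (1 - t\<^sup>2) *\<^sub>R D y t) x)"

definition legendre_sq :: "(real \<Rightarrow> complex) \<Rightarrow> real \<Rightarrow> complex" where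
  "legendre_sq y = (\<lambda>x. D (D (\<lambda>t. (1 - t\<^sup>2)\<^sup>2 *\<^sub>R D (D y) t)) x
                      - 2 * D (\<lambda>t. (1 - t\<^sup>2) *\<^sub>R D y t) x)"

definition form2 :: "(real \<Rightarrow> complex) \<Rightarrow> (real \<Rightarrow> complex) \<Rightarrow> real \<Rightarrow> complex" where
  "form2 f g = (\<lambda>x. let gb = (\<lambda>t. cnj (g t)) in
       D (\<lambda>t. (1 - t\<^sup>2)\<^sup>2 *\<^sub>R D (D f) t) x * gb x
     - D (\<lambda>t. (1 - t\<^sup>2)\<^sup>2 *\<^sub>R D (D gb) t) x * f x
     - (1 - x\<^sup>2)\<^sup>2 *\<^sub>R (D (D f) x * D gb x)
     + (1 - x\<^sup>2)\<^sup>2 *\<^sub>R (D f x * D (D gb) x)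
     - 2 * (1 - x\<^sup>2) *\<^sub>R (D f x * gb x)
     + 2 * (1 - x\<^sup>2) *\<^sub>R (f x * D gb x))"

text \<open>Functions on \<open>(-1,1)\<close> are represented by the functions that are
  \<^const>\<open>undefined\<close> outside this interval, so that equality of domains is literal.\<close>

definition dom_A :: "(real \<Rightarrow> complex) set" where
  "dom_A = {f \<in> extensional Iop. f \<in> AC_loc_upto 1 \<and> f \<in> L2 \<and> legendre f \<in> L2 \<and>
              lim_ends_zero (\<lambda>x. (1 - x\<^sup>2) *\<^sub>R D f x)}"

text \<open>\<open>A f\<close> is an element of \<open>L\<^sup>2\<close>, hence belongs to \<^const>\<open>dom_A\<close> if it has a
  representative there.\<close>

definition dom_A2 :: "(real \<Rightarrow> complex) set" where
  "dom_A2 = {f \<in> dom_A. \<exists>g\<in>dom_A. AE x in lebesgue_on Iop. g x = legendre f x}"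

definition dom_S :: "(real \<Rightarrow> complex) set" where
  "dom_S = {f \<in> extensional Iop. f \<in> AC_loc_upto 3 \<and> f \<in> L2 \<and> legendre_sq f \<in> L2 \<and>
              lim_ends_zero (form2 f (\<lambda>x. 1)) \<and>
              lim_ends_zero (form2 f (\<lambda>x. complex_of_real x))}"

lemma D_const [simp]: "D (\<lambda>x. c) = (\<lambda>x. 0)"
  by (simp add: D_def)

lemma D_of_real [simp]: "D complex_of_real = (\<lambda>x. 1)"
  unfolding D_def
  by (intro ext vector_derivative_at) (auto intro!: derivative_eq_intros)

lemma form2_one:
  "form2 f (\<lambda>x. 1) x =
     D (\<lambda>t. (1 - t\<^sup>2)\<^sup>2 *\<^sub>R D (D f) t) x - 2 * (1 - x\<^sup>2) *\<^sub>R D f x"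
  by (simp add: form2_def)

lemma form2_id:
  "form2 f (\<lambda>x. complex_of_real x) x =
     x *\<^sub>R form2 f (\<lambda>x. 1) x - (1 - x\<^sup>2)\<^sup>2 *\<^sub>R D (D f) x + 2 * (1 - x\<^sup>2) *\<^sub>R f x"
  by (simp add: form2_def scaleR_conv_of_real algebra_simps)

end

theory Submission
  imports Defs
begin

text \<open>
  Write \<open>p = 1 - x\<^sup>2\<close> and \<open>h = \<ell>[f]\<close>. Then \<open>[f,1]\<^sub>2 = - p h'\<close>,
  \<open>[f,x]\<^sub>2 = - x p h' - 2 x p f' + p h + 2 p f\<close> and \<open>\<ell>\<^sup>2[f] = \<ell>[h]\<close> almost everywhere.
  If \<open>p h'\<close> vanishes at the ends, \<open>h\<close> grows at most logarithmically; hence \<open>h\<close> is square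
  integrable, \<open>p h\<close> tends to \<open>0\<close>, and \<open>p f'\<close>, whose derivative is \<open>- h\<close>, is bounded. The last fact makes
  \<open>f\<close> logarithmic too, so \<open>p f\<close> tends to \<open>0\<close> and the condition on \<open>[f,x]\<^sub>2\<close> says
  exactly that \<open>p f'\<close> tends to \<open>0\<close>.

  Conversely, if \<open>(p f')' = - g\<close> almost everywhere with \<open>p f'\<close> locally absolutely continuous and \<open>g\<close>
  continuous, then the equation holds everywhere and \<open>f\<close> inherits two further derivatives
  from \<open>g\<close>. This needs that absolutely continuous functions are
  differentiable almost everywhere, which is shown by a Vitali argument: if difference quotients
  below \<open>r\<close> and above \<open>s > r\<close> both occurred on a set of positive outer measure, a disjoint family of
  intervals of slope \<open>\<le> r\<close> would be almost filled by intervals of slope \<open>\<ge> s\<close>, while absolute continuity makes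
  the increments over the gaps negligible.
\<close>

section \<open>Almost everywhere differentiability of absolutely continuous functions\<close>

text \<open>Covering and gauge arguments produce their intervals as divisions. Enumerating the
  finite set \<open>p\<close> gives an indexed family as in the definition, and disjoint interiors
  become disjoint open intervals.\<close>

lemma abs_cont_on_division:
  assumes F: "abs_cont_on a b F" and "\<epsilon> > 0"
  obtains \<delta> where "\<delta> > 0"
    "\<And>p. \<lbrakk>p division_of \<Union>p; \<Union>p \<subseteq> {a..b}; sum (measure lborel) p < \<delta>\<rbrakk>
       \<Longrightarrow> (\<Sum>k\<in>p. norm (F (Sup k) - F (Inf k))) < \<epsilon>"
proof -
  have "\<exists>\<delta>>0. \<forall>(n::nat) u v.
        (\<forall>i<n. a \<le> u i \<and> u i \<le> v i \<and> v i \<le> b) \<and>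
        disjoint_family_on (\<lambda>i. {u i<..<v i}) {..<n} \<and>
        (\<Sum>i<n. v i - u i) < \<delta>
        \<longrightarrow> (\<Sum>i<n. norm (F (v i) - F (u i))) < \<epsilon>"
    using F \<open>\<epsilon> > 0\<close> unfolding abs_cont_on_def by simp
  then obtain \<delta> where "\<delta> > 0" and \<delta>: "\<forall>(n::nat) u v.
        (\<forall>i<n. a \<le> u i \<and> u i \<le> v i \<and> v i \<le> b) \<and>
        disjoint_family_on (\<lambda>i. {u i<..<v i}) {..<n} \<and>
        (\<Sum>i<n. v i - u i) < \<delta>
        \<longrightarrow> (\<Sum>i<n. norm (F (v i) - F (u i))) < \<epsilon>"
    by (elim exE conjE)
  show thesis
  proof (rule that[OF \<open>\<delta> > 0\<close>])
    fix p assume p: "p division_of \<Union>p" "\<Union>p \<subseteq> {a..b}" "sum (measure lborel) p < \<delta>"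
    note pd = division_ofD[OF p(1)]
    obtain h where h: "bij_betw h {..<card p} p"
      using ex_bij_betw_nat_finite[OF pd(1)] by (auto simp: lessThan_atLeast0)
    have k: "k \<noteq> {} \<and> k = {Inf k..Sup k} \<and> Inf k \<le> Sup k \<and> a \<le> Inf k \<and> Sup k \<le> b \<and> measure lborel k = Sup k - Inf k
         \<and> interior k = {Inf k<..<Sup k}" if kp: "k \<in> p" for k
    proof -
      obtain c d where cd: "k = {c..d}" using pd(4)[OF kp] by (auto simp: cbox_interval)
      with pd(3)[OF kp] have "c \<le> d" by auto
      moreover have "k \<subseteq> {a..b}" using p(2) kp by auto
      ultimately show ?thesis using cd by (auto simp: interior_atLeastAtMost_real)
    qed
    have hp: "h i \<in> p" if "i < card p" for i using h that by (auto simp: bij_betw_def)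
    have "(\<Sum>i<card p. norm (F (Sup (h i)) - F (Inf (h i)))) < \<epsilon>"
    proof (rule \<delta>[rule_format], intro conjI)
      show "\<forall>i<card p. a \<le> Inf (h i) \<and> Inf (h i) \<le> Sup (h i) \<and> Sup (h i) \<le> b"
        by (intro allI impI) (simp add: k hp)
      show "disjoint_family_on (\<lambda>i. {Inf (h i)<..<Sup (h i)}) {..<card p}"
        unfolding disjoint_family_on_def
      proof (intro ballI impI)
        fix i j assume ij: "i \<in> {..<card p}" "j \<in> {..<card p}" "i \<noteq> j"
        then have "h i \<noteq> h j" using h by (auto simp: bij_betw_def inj_on_def)
        with pd(5)[OF hp hp, of i j] ij k[OF hp, of i] k[OF hp, of j]
        show "{Inf (h i)<..<Sup (h i)} \<inter> {Inf (h j)<..<Sup (h j)} = {}"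
          by auto
      qed
      have "(\<Sum>i<card p. Sup (h i) - Inf (h i)) = (\<Sum>i<card p. measure lborel (h i))"
        using k hp by (intro sum.cong) auto
      also have "\<dots> = sum (measure lborel) p" using h by (rule sum.reindex_bij_betw)
      finally show "(\<Sum>i<card p. Sup (h i) - Inf (h i)) < \<delta>" using p(3) by simp
    qed
    also have "(\<Sum>i<card p. norm (F (Sup (h i)) - F (Inf (h i)))) = (\<Sum>k\<in>p. norm (F (Sup k) - F (Inf k)))"
      using h by (rule sum.reindex_bij_betw)
    finally show "(\<Sum>k\<in>p. norm (F (Sup k) - F (Inf k))) < \<epsilon>" .
  qed
qed

text \<open>Tagging every interval with its left end reduces this to telescoping over a tagged
  division.\<close>

lemma additive_division_real:
  fixes f :: "real \<Rightarrow> 'a::real_normed_vector"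
  assumes "a \<le> b" and p: "p division_of {a..b}"
  shows "(\<Sum>k\<in>p. f (Sup k) - f (Inf k)) = f b - f a"
proof -
  have "(\<lambda>k. (Inf k, k)) ` p tagged_division_of {a..b}"
  proof (rule tagged_division_ofI)
    note pd = division_ofD[OF p]
    show "finite ((\<lambda>k. (Inf k, k)) ` p)" using pd by auto
    fix x k assume *: "(x, k) \<in> (\<lambda>k. (Inf k, k)) ` p"
    then obtain c d where cd: "k = {c..d}" "c \<le> d"
      using pd(3)[of k] pd(4)[of k] by fastforce
    show "k \<subseteq> {a..b}" using * pd(2)[of k] by auto
    show "x \<in> k" "\<exists>a b. k = cbox a b" using * cd by auto
    fix x' k' assume "(x', k') \<in> (\<lambda>k. (Inf k, k)) ` p" "(x, k) \<noteq> (x', k')"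
    then show "interior k \<inter> interior k' = {}" using pd(5)[of k k'] * by auto
  next
    have "{k. \<exists>x. (x, k) \<in> (\<lambda>k. (Inf k, k)) ` p} = p" by auto
    then show "\<Union>{k. \<exists>x. (x, k) \<in> (\<lambda>k. (Inf k, k)) ` p} = {a..b}"
      using division_ofD(6)[OF p] by simp
  qed
  from additive_tagged_division_1[OF \<open>a \<le> b\<close> this, of f] show ?thesis
    by (subst (asm) sum.reindex) (auto simp: inj_on_def)
qed

text \<open>Vitali's theorem gives countably many disjoint intervals covering \<open>E\<close> up to
  a null set. Their union lies in the bounded set \<open>U\<close>, so finitely many of them already
  exhaust its measure up to \<open>\<eta>\<close>.\<close>

lemma finite_Vitali_intervals:
  fixes E U :: "real set"
  assumes U: "open U" "bounded U" "E \<subseteq> U" and "\<eta> > 0"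
    and cover: "\<And>x d. \<lbrakk>x \<in> E; d > 0\<rbrakk> \<Longrightarrow> \<exists>u v. u \<le> x \<and> x \<le> v \<and> u < v \<and> v - u < d \<and> P u v"
  obtains p T where "p division_of \<Union>p" "pairwise disjnt p" "\<Union>p \<subseteq> U"
    "\<And>k. k \<in> p \<Longrightarrow> \<exists>u v. u < v \<and> k = {u..v} \<and> P u v"
    "T \<in> lmeasurable" "measure lebesgue T < \<eta>" "E \<subseteq> \<Union>p \<union> T"
proof -
  define K where "K = {(u,v). u < v \<and> P u v \<and> {u..v} \<subseteq> U}"
  define A where "A = (\<lambda>(u::real,v). (u+v)/2)"
  define R where "R = (\<lambda>(u::real,v). (v-u)/2)"
  define I where "I = (\<lambda>(u::real,v). {u..v})"
  have I: "cball (A i) (R i) = I i" for i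
    by (auto simp: A_def R_def I_def cball_eq_atLeastAtMost field_simps split: prod.split)
  have R: "R i > 0" if "i \<in> K" for i using that by (auto simp: R_def K_def)
  have C: "\<exists>i. i \<in> K \<and> x \<in> cball (A i) (R i) \<and> R i < d" if x: "x \<in> E" "d > 0" for x d
  proof -
    obtain e where e: "e > 0" "ball x e \<subseteq> U" using U x by (meson openE subsetD)
    obtain u v where uv: "u \<le> x" "x \<le> v" "u < v" "v - u < min d e" "P u v"
      using cover[of x "min d e"] x e by auto
    have "{u..v} \<subseteq> ball x e" using uv by (auto simp: dist_real_def)
    then have "(u,v) \<in> K" using uv e by (auto simp: K_def)
    then show ?thesis using uv by (intro exI[of _ "(u,v)"]) (auto simp: I I_def, auto simp: R_def)
  qed
  obtain C where C: "countable C" "C \<subseteq> K" 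
     "pairwise (\<lambda>i j. disjnt (cball (A i) (R i)) (cball (A j) (R j))) C"
     "negligible(E - (\<Union>i \<in> C. cball (A i) (R i)))"
    using Vitali_covering_theorem_cballs[of K R E A, OF R C] by blast
  \<comment> \<open>The enumeration of \<open>C\<close> yields finite partial unions that increase
    to the whole union \<open>X\<close>; continuity from below then supplies a suitable
    \<open>n\<close>.\<close>
  define B where "B n = (\<Union>i \<in> {i \<in> C. to_nat_on C i < n}. I i)" for n
  define X where "X = (\<Union>i\<in>C. I i)"
  have XU: "X \<subseteq> U" using C(2) by (auto simp: X_def I_def K_def)
  have Imeas: "I i \<in> sets lebesgue" for i by (auto simp: I_def split: prod.split)
  have Xm: "X \<in> lmeasurable"
  proof (rule bounded_set_imp_lmeasurable)
    show "bounded X" using XU U(2) by (rule bounded_subset[rotated])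
    show "X \<in> sets lebesgue" unfolding X_def using C(1) Imeas by (intro sets.countable_UN') auto
  qed
  have BX: "B n \<subseteq> X" for n by (auto simp: B_def X_def)
  have finC: "finite {i \<in> C. to_nat_on C i < n}" for n
  proof -
    have "finite (to_nat_on C ` {i \<in> C. to_nat_on C i < n})"
      by (rule finite_subset[of _ "{..<n}"]) auto
    moreover have "inj_on (to_nat_on C) {i \<in> C. to_nat_on C i < n}"
      by (rule inj_on_subset[OF inj_on_to_nat_on[OF C(1)]]) auto
    ultimately show ?thesis by (rule finite_imageD)
  qed
  have Bm: "B n \<in> lmeasurable" for n
    unfolding B_def using finC
    by (intro fmeasurable.finite_UN) (auto simp: I_def split: prod.split)
  have "(\<lambda>n. measure lebesgue (B n)) \<longlonglongrightarrow> measure lebesgue (\<Union>n. B n)"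
  proof (rule Lim_measure_incseq)
    show "range B \<subseteq> sets lebesgue" using Bm by auto
    show "incseq B" by (auto simp: incseq_def B_def)
    have "(\<Union>n. B n) = X" by (auto simp: B_def X_def)
    then show "emeasure lebesgue (\<Union>n. B n) \<noteq> \<infinity>" using Xm by (auto simp: fmeasurable_def)
  qed
  also have "(\<Union>n. B n) = X" by (auto simp: B_def X_def)
  finally have "\<forall>\<^sub>F n in sequentially. measure lebesgue X - \<eta> < measure lebesgue (B n)"
    using \<open>\<eta> > 0\<close> by (intro order_tendstoD) auto
  then obtain n where n: "measure lebesgue X - \<eta> < measure lebesgue (B n)"
    by (auto simp: eventually_sequentially)
  define p where "p = I ` {i \<in> C. to_nat_on C i < n}"
  have pI: "\<exists>u v. u < v \<and> k = {u..v} \<and> P u v" if "k \<in> p" for k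
    using that C(2) by (auto simp: p_def I_def K_def)
  have dj: "pairwise disjnt p"
    using C(3) by (auto simp: pairwise_def p_def I) 
  have "\<Union>p = B n" by (auto simp: p_def B_def)
  \<comment> \<open>The exceptional set consists of the intervals left out, which have measure below
    \<open>\<eta>\<close>, and the null set missed by the Vitali family.\<close>
  show thesis
  proof (rule that[of p "(X - B n) \<union> (E - X)"])
    show "p division_of \<Union>p"
    proof (rule division_ofI)
      show "finite p" using finC by (auto simp: p_def)
      fix k assume k: "k \<in> p"
      then show "k \<noteq> {}" "\<exists>a b. k = cbox a b" "k \<subseteq> \<Union>p" using pI[OF k] by auto
      fix k' assume "k' \<in> p" "k \<noteq> k'"
      then show "interior k \<inter> interior k' = {}"
        using dj k interior_subset[of k] interior_subset[of k']
        unfolding pairwise_def disjnt_def by blast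
    qed auto
    have N: "negligible (E - X)" using C(4) by (simp add: X_def I)
    show "X - B n \<union> (E - X) \<in> lmeasurable" 
      using fmeasurable.Un[OF fmeasurable_Diff[OF Xm] negligible_imp_measurable[OF N]] Bm
      by (simp add: fmeasurableD)
    have "measure lebesgue (X - B n \<union> (E - X)) = measure lebesgue (X - B n)"
      using N Xm Bm by (intro measure_Un_null_set) (auto simp: negligible_iff_null_sets)
    also have "\<dots> = measure lebesgue X - measure lebesgue (B n)"
      using Xm Bm BX by (intro measurable_measure_Diff) auto
    finally show "measure lebesgue (X - B n \<union> (E - X)) < \<eta>" using n by simp
    show "E \<subseteq> \<Union> p \<union> (X - B n \<union> (E - X))" using \<open>\<Union>p = B n\<close> by auto
    show "\<Union>p \<subseteq> U" using \<open>\<Union>p = B n\<close> BX XU by auto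
  qed (use dj pI in auto)
qed

section \<open>Length and increments over divisions, and outer measure\<close>

lemma division_content_sum:
  assumes "p division_of \<Union>p"
  shows "\<Union>p \<in> lmeasurable" "measure lebesgue (\<Union>p) = sum (measure lborel) p"
proof -
  have b: "K \<in> sets borel" "bounded K" if "K \<in> p" for K 
    using division_ofD(4)[OF assms that] by auto
  then have "measure lborel K = measure lebesgue K" if "K \<in> p" for K 
    using that by (auto simp: measure_completion)
  then show "measure lebesgue (\<Union>p) = sum (measure lborel) p"
    using content_division[OF assms] by simp
  show "\<Union>p \<in> lmeasurable"
    using lmeasurable_division[OF assms] .
qed

lemma division_UNION:
  assumes F: "F division_of S" and q: "\<And>I. I \<in> F \<Longrightarrow> q I division_of I"
  shows "(\<Union>I\<in>F. q I) division_of S"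
proof (rule division_ofI)
  show "finite (\<Union>I\<in>F. q I)" using division_ofD(1)[OF F] division_ofD(1)[OF q] by auto
  have "\<Union>(\<Union>I\<in>F. q I) = (\<Union>I\<in>F. \<Union>(q I))" by auto
  also have "\<dots> = \<Union>F" using division_ofD(6)[OF q] by auto
  finally show S: "\<Union>(\<Union>I\<in>F. q I) = S" using division_ofD(6)[OF F] by simp
  fix k assume "k \<in> (\<Union>I\<in>F. q I)"
  then obtain I where I: "I \<in> F" "k \<in> q I" by auto
  then show "k \<noteq> {}" "\<exists>a b. k = cbox a b" "k \<subseteq> S" 
    using division_ofD(3,4)[OF q[OF I(1)] I(2)] S by auto
  fix k' assume "k' \<in> (\<Union>I\<in>F. q I)" and ne: "k \<noteq> k'"
  then obtain J where J: "J \<in> F" "k' \<in> q J" by auto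
  show "interior k \<inter> interior k' = {}"
  proof (cases "I = J")
    case True
    then show ?thesis using division_ofD(5)[OF q[OF I(1)] I(2), of k'] J ne by auto
  next
    case False
    have "interior k \<subseteq> interior I" "interior k' \<subseteq> interior J"
      using division_ofD(2)[OF q[OF I(1)] I(2)] division_ofD(2)[OF q[OF J(1)] J(2)]
      by (simp_all add: interior_mono)
    then show ?thesis using division_ofD(5)[OF F I(1) J(1) False] by auto
  qed
qed

text \<open>Since members of \<open>F\<close> are disjoint and members of a division are nonempty,
  no interval lies in two of the \<open>q I\<close>. The sum therefore splits over \<open>F\<close>,
  and each inner sum telescopes.\<close>

lemma sum_division_UNION:
  fixes G :: "real \<Rightarrow> real"
  assumes F: "F division_of \<Union>F" "pairwise disjnt F" and q: "\<And>I. I \<in> F \<Longrightarrow> q I division_of I"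
  shows "(\<Sum>k\<in>(\<Union>I\<in>F. q I). G (Sup k) - G (Inf k)) = (\<Sum>I\<in>F. G (Sup I) - G (Inf I))"
proof -
  have "(\<Sum>k\<in>(\<Union>I\<in>F. q I). G (Sup k) - G (Inf k)) = (\<Sum>I\<in>F. \<Sum>k\<in>q I. G (Sup k) - G (Inf k))"
  proof (rule sum.UNION_disjoint)
    show "finite F" "\<forall>I\<in>F. finite (q I)" using division_ofD(1)[OF F(1)] division_ofD(1)[OF q] by auto
    show "\<forall>I\<in>F. \<forall>J\<in>F. I \<noteq> J \<longrightarrow> q I \<inter> q J = {}"
    proof (intro ballI impI)
      fix I J assume IJ: "I \<in> F" "J \<in> F" "I \<noteq> J"
      then have "I \<inter> J = {}" using F(2) by (auto simp: pairwise_def disjnt_def)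
      then show "q I \<inter> q J = {}"
        using division_ofD(2,3)[OF q[OF IJ(1)]] division_ofD(2)[OF q[OF IJ(2)]] by blast
    qed
  qed
  also have "\<dots> = (\<Sum>I\<in>F. G (Sup I) - G (Inf I))"
  proof (rule sum.cong[OF refl])
    fix I assume I: "I \<in> F"
    obtain c d where cd: "I = {c..d}" using division_ofD(4)[OF F(1) I] by (auto simp: cbox_interval)
    with division_ofD(3)[OF F(1) I] have "c \<le> d" by auto
    then show "(\<Sum>k\<in>q I. G (Sup k) - G (Inf k)) = G (Sup I) - G (Inf I)"
      using additive_division_real[of c d "q I" G] q[OF I] cd by simp
  qed
  finally show ?thesis .
qed

text \<open>The number \<open>m\<close> is the Lebesgue outer measure of \<open>E\<close>, the
  infimum over measurable supersets. It replaces the measure because the sets of bad points are not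
  known to be measurable; open supersets of almost minimal measure come from outer
  regularity.\<close>

lemma not_negligible_outer_measure:
  assumes "\<not> negligible E" and "E \<subseteq> S" "open S" "bounded S"
  obtains m where "m > 0" "\<And>T. \<lbrakk>E \<subseteq> T; T \<in> lmeasurable\<rbrakk> \<Longrightarrow> m \<le> measure lebesgue T"
    "\<And>\<eta>. \<eta> > 0 \<Longrightarrow> \<exists>U. open U \<and> E \<subseteq> U \<and> U \<subseteq> S \<and> measure lebesgue U < m + \<eta>"
proof -
  define M where "M = {measure lebesgue T |T. E \<subseteq> T \<and> T \<in> lmeasurable}"
  obtain e where e: "e > 0" "\<And>T. \<lbrakk>E \<subseteq> T; T \<in> lmeasurable\<rbrakk> \<Longrightarrow> e \<le> measure lebesgue T"
    using assms(1) unfolding negligible_outer by (meson not_le)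
  have Sm: "S \<in> lmeasurable" using assms by (auto intro: bounded_set_imp_lmeasurable)
  have ne: "M \<noteq> {}" using assms Sm by (auto simp: M_def)
  have bd: "bdd_below M" unfolding M_def by (rule bdd_belowI[of _ 0]) auto
  show thesis
  proof (rule that[of "Inf M"])
    have "e \<le> Inf M" using ne e by (intro cInf_greatest) (auto simp: M_def)
    then show "Inf M > 0" using e by simp
    show "Inf M \<le> measure lebesgue T" if "E \<subseteq> T" "T \<in> lmeasurable" for T
      using that bd by (intro cInf_lower) (auto simp: M_def)
    show "\<exists>U. open U \<and> E \<subseteq> U \<and> U \<subseteq> S \<and> measure lebesgue U < Inf M + \<eta>" if "\<eta> > 0" for \<eta>
    proof -
      have "\<exists>x\<in>M. x < Inf M + \<eta>/2" using ne bd that by (intro cInf_lessD) auto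
      then obtain T where T: "E \<subseteq> T" "T \<in> lmeasurable" "measure lebesgue T < Inf M + \<eta>/2"
        by (auto simp: M_def)
      have "T \<in> sets lebesgue" using T by auto
      then obtain V where V: "open V" "T \<subseteq> V" "V - T \<in> lmeasurable" "emeasure lebesgue (V - T) < ennreal (\<eta>/2)"
        using sets_lebesgue_outer_open[of T "\<eta>/2"] half_gt_zero[OF \<open>\<eta> > 0\<close>] by blast
      have "measure lebesgue (V - T) < \<eta>/2" 
        using V(3,4) that by (simp add: emeasure_eq_measure2 ennreal_less_iff)
      moreover have "measure lebesgue (V \<inter> S) \<le> measure lebesgue (T \<union> (V - T))"
        using T V assms by (intro measure_mono_fmeasurable fmeasurable.Un) auto
      moreover have "measure lebesgue (T \<union> (V - T)) \<le> measure lebesgue T + measure lebesgue (V - T)"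
        using T V by (intro measure_Un_le) auto
      ultimately have "measure lebesgue (V \<inter> S) < Inf M + \<eta>" using T(3) by linarith
      then show ?thesis using V assms T by (intro exI[of _ "V \<inter> S"]) auto
    qed
  qed
qed

text \<open>Let \<open>m\<close> be the outer measure of \<open>E\<close>, and write |X| for the
  total length of a family X. The increment over the family \<open>F\<close> of flat intervals is at
  most \<open>p\<close> |F|. The steep intervals \<open>H\<close> inside them contribute at least
  \<open>q\<close> |H|, and the remaining pieces \<open>N\<close> are short. As |H| and |F| are both
  close to \<open>m\<close>, this contradicts \<open>p < q\<close>.\<close>

lemma two_slopes_negligible:
  fixes G :: "real \<Rightarrow> real"
  assumes ac: "abs_cont_on a b (\<lambda>x. complex_of_real (G x))" and E: "E \<subseteq> {a<..<b}" and "p < q"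
    and lo: "\<And>x d. \<lbrakk>x \<in> E; d > 0\<rbrakk> \<Longrightarrow> \<exists>u v. u \<le> x \<and> x \<le> v \<and> u < v \<and> v - u < d \<and> G v - G u \<le> p * (v - u)"
    and hi: "\<And>x d. \<lbrakk>x \<in> E; d > 0\<rbrakk> \<Longrightarrow> \<exists>u v. u \<le> x \<and> x \<le> v \<and> u < v \<and> v - u < d \<and> q * (v - u) \<le> G v - G u"
  shows "negligible E"
proof (rule ccontr)
  assume "\<not> negligible E"
  then obtain m where m: "m > 0" "\<And>T. \<lbrakk>E \<subseteq> T; T \<in> lmeasurable\<rbrakk> \<Longrightarrow> m \<le> measure lebesgue T"
    "\<And>\<eta>. \<eta> > 0 \<Longrightarrow> \<exists>U. open U \<and> E \<subseteq> U \<and> U \<subseteq> {a<..<b} \<and> measure lebesgue U < m + \<eta>"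
    using not_negligible_outer_measure[OF _ E] by (metis bounded_box(1) box_real(1) open_greaterThanLessThan)
  \<comment> \<open>With this scale the estimates end in \<open>6 * \<epsilon>\<close> being at most
    (q - p) |H|, which is below \<open>2 * \<epsilon>\<close>.\<close>
  define \<epsilon> where "\<epsilon> = (q - p) * m / 8"
  have \<epsilon>: "\<epsilon> > 0" using m \<open>p < q\<close> by (simp add: \<epsilon>_def)
  obtain \<delta> where \<delta>: "\<delta> > 0" "\<And>p. \<lbrakk>p division_of \<Union>p; \<Union>p \<subseteq> {a..b}; sum (measure lborel) p < \<delta>\<rbrakk>
       \<Longrightarrow> (\<Sum>k\<in>p. norm (complex_of_real (G (Sup k)) - complex_of_real (G (Inf k)))) < \<epsilon>"
    using abs_cont_on_division[OF ac \<epsilon>] by blast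
  \<comment> \<open>The three bounds serve in turn to make |H| at least 3m/4, to make |N| smaller
    than \<open>\<delta>\<close>, and to make \<open>p\<close> |N| at most
    \<open>\<epsilon>\<close>.\<close>
  define \<eta> where "\<eta> = min (m / 8) (min (\<delta> / 4) (\<epsilon> / (4 * (\<bar>p\<bar> + 1))))"
  have "\<epsilon> / (4 * (\<bar>p\<bar> + 1)) > 0" using \<epsilon> by simp
  then have \<eta>: "\<eta> > 0" "\<eta> \<le> m / 8" "\<eta> \<le> \<delta> / 4" "\<eta> \<le> \<epsilon> / (4 * (\<bar>p\<bar> + 1))"
    using m(1) \<delta>(1) \<epsilon> unfolding \<eta>_def by linarith+
  obtain U where U: "open U" "E \<subseteq> U" "U \<subseteq> {a<..<b}" "measure lebesgue U < m + \<eta>"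
    using m(3)[OF \<eta>(1)] by blast
  have bU: "bounded U" using U(3) by (rule bounded_subset[rotated]) simp
  obtain F T where F: "F division_of \<Union>F" "pairwise disjnt F" "\<Union>F \<subseteq> U"
    "\<And>k. k \<in> F \<Longrightarrow> \<exists>u v. u < v \<and> k = {u..v} \<and> G v - G u \<le> p * (v - u)"
    "T \<in> lmeasurable" "measure lebesgue T < \<eta>" "E \<subseteq> \<Union>F \<union> T"
    by (rule finite_Vitali_intervals[OF U(1) bU U(2) \<eta>(1), of "\<lambda>u v. G v - G u \<le> p * (v - u)"])
      (erule (1) lo, blast)
  \<comment> \<open>A point in the interior of a flat interval has a neighbourhood inside it, so
    sufficiently short steep intervals around the point fit into that single interval.\<close>
  define V where "V = (\<Union>I\<in>F. interior I)"
  have V: "open V" "bounded V" "E \<inter> V \<subseteq> V"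
    using F(3) bU interior_subset by (auto simp: V_def intro!: bounded_subset[OF bU])
  have cover: "\<exists>u v. u \<le> x \<and> x \<le> v \<and> u < v \<and> v - u < d \<and> q * (v - u) \<le> G v - G u \<and> (\<exists>I\<in>F. {u..v} \<subseteq> I)"
    if x: "x \<in> E \<inter> V" "d > 0" for x d
  proof -
    obtain I where I: "I \<in> F" "x \<in> interior I" using x by (auto simp: V_def)
    obtain e where e: "e > 0" "ball x e \<subseteq> I" using I(2) by (auto simp: mem_interior)
    obtain u v where uv: "u \<le> x" "x \<le> v" "u < v" "v - u < min d e" "q * (v - u) \<le> G v - G u"
      using hi[of x "min d e"] x e by auto
    have "{u..v} \<subseteq> ball x e" using uv by (auto simp: dist_real_def)
    then show ?thesis using uv I e by (intro exI[of _ u] exI[of _ v]) auto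
  qed
  obtain H T' where H: "H division_of \<Union>H" "pairwise disjnt H" "\<Union>H \<subseteq> V"
    "\<And>k. k \<in> H \<Longrightarrow> \<exists>u v. u < v \<and> k = {u..v} \<and> q * (v - u) \<le> G v - G u \<and> (\<exists>I\<in>F. {u..v} \<subseteq> I)"
    "T' \<in> lmeasurable" "measure lebesgue T' < \<eta>" "E \<inter> V \<subseteq> \<Union>H \<union> T'"
    by (rule finite_Vitali_intervals[OF V \<eta>(1), of "\<lambda>u v. q * (v - u) \<le> G v - G u \<and> (\<exists>I\<in>F. {u..v} \<subseteq> I)"])
      (erule (1) cover, blast)
  \<comment> \<open>The steep intervals inside \<open>I\<close> are completed to a division of
    \<open>I\<close>; the pieces added over all \<open>I\<close> form \<open>N\<close>
    below.\<close>
  have "\<exists>q. {J \<in> H. J \<subseteq> I} \<subseteq> q \<and> q division_of I" if IF: "I \<in> F" for I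
  proof -
    obtain c d where cd: "I = cbox c d" using F(4)[OF IF] by (auto simp: cbox_interval)
    have "{J \<in> H. J \<subseteq> I} division_of \<Union>{J \<in> H. J \<subseteq> I}"
      by (rule division_of_subset[OF H(1)]) auto
    moreover have "\<Union>{J \<in> H. J \<subseteq> I} \<subseteq> cbox c d" using cd by auto
    ultimately obtain q where "{J \<in> H. J \<subseteq> I} \<subseteq> q" "q division_of cbox c d"
      by (rule partial_division_extend_interval)
    then show ?thesis using cd by blast
  qed
  then have "\<forall>I\<in>F. \<exists>q. {J \<in> H. J \<subseteq> I} \<subseteq> q \<and> q division_of I" by simp
  then obtain r where "\<forall>I\<in>F. {J \<in> H. J \<subseteq> I} \<subseteq> r I \<and> r I division_of I"
    by (elim bchoice[THEN exE])
  then have r: "\<And>I. I \<in> F \<Longrightarrow> {J \<in> H. J \<subseteq> I} \<subseteq> r I" "\<And>I. I \<in> F \<Longrightarrow> r I division_of I"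
    by simp_all
  define Q where "Q = (\<Union>I\<in>F. r I)"
  have Q: "Q division_of \<Union>F" unfolding Q_def using F(1) r(2) by (rule division_UNION)
  have UQ: "\<Union>Q = \<Union>F" using division_ofD(6)[OF Q] .
  have finQ: "finite Q" using division_ofD(1)[OF Q] .
  have HQ: "H \<subseteq> Q" using H(4) r(1) unfolding Q_def by blast
  define N where "N = Q - H"
  have N: "N division_of \<Union>N" unfolding N_def by (rule division_of_subset[of Q]) (use Q UQ in auto)
  let ?c = "sum (measure lborel)"
  let ?\<Delta> = "sum (\<lambda>k. G (Sup k) - G (Inf k))"
  have cQ: "?c Q = ?c F" 
    using division_content_sum(2)[OF F(1)] division_content_sum(2)[of Q] Q UQ by simp
  have cQ2: "?c Q = ?c H + ?c N" "?\<Delta> Q = ?\<Delta> H + ?\<Delta> N"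
    unfolding N_def using finQ HQ by (simp_all add: sum.subset_diff)
  have "?\<Delta> F \<le> (\<Sum>k\<in>F. p * measure lborel k)"
    using F(4) by (intro sum_mono) force
  then have FF: "?\<Delta> Q \<le> p * ?c F"
    using sum_division_UNION[OF F(1,2) r(2), of G] by (simp add: Q_def sum_distrib_left)
  have "(\<Sum>k\<in>H. q * measure lborel k) \<le> ?\<Delta> H"
    using H(4) by (intro sum_mono) force
  then have HH: "q * ?c H \<le> ?\<Delta> H"
    by (simp add: sum_distrib_left)
  have "\<Union>F \<subseteq> U" by fact
  then have "measure lebesgue (\<Union>F) \<le> measure lebesgue U"
    using U(1) bU F(1) division_content_sum(1)[OF F(1)]
    by (intro measure_mono_fmeasurable bounded_set_imp_lmeasurable) auto
  then have cF: "?c F < m + \<eta>" using division_content_sum(2)[OF F(1)] U(4) by simp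
  have "m \<le> ?c H + 2 * \<eta>"
  proof -
    \<comment> \<open>Passing from \<open>F\<close> to the interiors loses only the finitely many
      end points, a null set.\<close>
    define Z where "Z = (\<Union>I\<in>F. {Inf I, Sup I})"
    have Z: "finite Z" using division_ofD(1)[OF F(1)] by (auto simp: Z_def)
    have FZ: "\<Union>F \<subseteq> V \<union> Z"
    proof
      fix x assume "x \<in> \<Union>F"
      then obtain I where I: "I \<in> F" "x \<in> I" by auto
      from F(4)[OF I(1)] obtain u v where "I = {u..v}" "u < v" by blast
      then show "x \<in> V \<union> Z" using I unfolding V_def Z_def
        by (cases "x = u \<or> x = v") (auto intro!: bexI[of _ I] simp: interior_atLeastAtMost_real)
    qed
    have ZN: "negligible Z" using Z by (rule negligible_finite)
    let ?X = "((\<Union>H \<union> T') \<union> T) \<union> Z"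
    have lm: "\<Union>H \<in> lmeasurable" "Z \<in> lmeasurable" 
      using division_content_sum(1)[OF H(1)] ZN negligible_imp_measurable by auto
    have "E \<subseteq> ?X" using F(7) H(7) FZ by blast
    then have "m \<le> measure lebesgue ?X"
      using lm H(5) F(5) by (intro m(2)) auto
    also have "\<dots> \<le> measure lebesgue (\<Union>H) + measure lebesgue T' + measure lebesgue T + measure lebesgue Z"
      using lm H(5) F(5) by (intro order.trans[OF measure_Un_le] add_mono) auto
    also have "measure lebesgue Z = 0" using ZN by (rule negligible_imp_measure0)
    finally show ?thesis using H(6) F(6) division_content_sum(2)[OF H(1)] by simp
  qed
  \<comment> \<open>|F| is below \<open>m + \<eta>\<close> and |H| is at least
    \<open>m - 2 * \<eta>\<close>; their difference is |N|.\<close>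
  then have cN: "?c N < 3 * \<eta>" "0 \<le> ?c N" using cF cQ cQ2 by (auto intro!: sum_nonneg)
  have "\<Union>N \<subseteq> \<Union>F" using UQ unfolding N_def by blast
  also have "\<dots> \<subseteq> {a<..<b}" using U(3) F(3) by (rule order.trans[rotated])
  also have "\<dots> \<subseteq> {a..b}" by (rule greaterThanLessThan_subseteq_atLeastAtMost_iff[THEN iffD2]) simp
  finally have "\<Union>N \<subseteq> {a..b}" .
  then have "(\<Sum>k\<in>N. norm (complex_of_real (G (Sup k)) - complex_of_real (G (Inf k)))) < \<epsilon>"
    using \<delta>(2)[OF N] cN \<eta>(1,3) by simp
  moreover have "- ?\<Delta> N \<le> (\<Sum>k\<in>N. norm (complex_of_real (G (Sup k)) - complex_of_real (G (Inf k))))"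
    unfolding sum_negf[symmetric] of_real_diff[symmetric] norm_of_real by (intro sum_mono) auto
  ultimately have "- ?\<Delta> N < \<epsilon>" by linarith
  then have "q * ?c H - \<epsilon> < p * (?c H + ?c N)" using FF HH cQ cQ2 by simp
  then have 1: "(q - p) * ?c H < \<epsilon> + p * ?c N" by (simp add: algebra_simps)
  have "p * ?c N \<le> \<bar>p\<bar> * (3 * \<eta>)" using cN by (intro mult_mono) auto
  also have "\<dots> \<le> (\<bar>p\<bar> + 1) * (4 * \<eta>)" using \<eta> by (intro mult_mono) auto
  also have "\<dots> \<le> \<epsilon>" using \<eta>(4) by (simp add: field_simps)
  finally have 2: "(q - p) * ?c H < 2 * \<epsilon>" using 1 by simp
  have "m * (3/4) \<le> ?c H" using \<open>m \<le> ?c H + 2 * \<eta>\<close> \<eta>(2) by simp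
  then have "(q - p) * (m * (3/4)) \<le> (q - p) * ?c H" using \<open>p < q\<close> by (intro mult_left_mono) auto
  moreover have "(q - p) * (m * (3/4)) = 6 * \<epsilon>" by (simp add: \<epsilon>_def)
  ultimately show False using 2 \<epsilon> by linarith
qed

text \<open>Negligibility is local, so \<open>E\<close> may be cut down to a ball of total length
  below \<open>\<delta>\<close>. There all increments of a disjoint family sum to less than 1, and
  slopes of at least \<open>2 / e\<close> force the family to have length below
  \<open>e / 2\<close>.\<close>

lemma unbounded_slope_negligible:
  assumes ac: "abs_cont_on a b F" and E: "E \<subseteq> {a<..<b}"
    and hi: "\<And>x d n. \<lbrakk>x \<in> E; d > 0; n > 0\<rbrakk>
       \<Longrightarrow> \<exists>u v. u \<le> x \<and> x \<le> v \<and> u < v \<and> v - u < d \<and> n * (v - u) \<le> norm (F v - F u)"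
  shows "negligible E"
proof -
  obtain \<delta> where \<delta>: "\<delta> > 0" "\<And>p. \<lbrakk>p division_of \<Union>p; \<Union>p \<subseteq> {a..b}; sum (measure lborel) p < \<delta>\<rbrakk>
       \<Longrightarrow> (\<Sum>k\<in>p. norm (F (Sup k) - F (Inf k))) < 1"
    using abs_cont_on_division[OF ac zero_less_one] by blast
  show ?thesis
  proof (subst locally_negligible_alt, intro ballI exI conjI)
    fix x assume x: "x \<in> E"
    define B where "B = ball x (\<delta>/3) \<inter> {a<..<b}"
    show "openin (top_of_set E) (E \<inter> B)" by (rule openin_open_Int) (auto simp: B_def)
    show "x \<in> E \<inter> B" using x E \<delta> by (auto simp: B_def)
    show "negligible (E \<inter> B)" unfolding negligible_outer
    proof (intro allI impI)
      fix e :: real assume e: "e > 0"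
      have cover: "\<exists>u v. u \<le> y \<and> y \<le> v \<and> u < v \<and> v - u < d \<and> 2 / e * (v - u) \<le> norm (F v - F u)"
        if "y \<in> E \<inter> B" "d > 0" for y d using hi[of y d "2/e"] that e by simp
      have B: "open B" "bounded B" "E \<inter> B \<subseteq> B" "e/2 > 0"
        using e by (auto simp: B_def)
      obtain p T where p: "p division_of \<Union>p" "pairwise disjnt p" "\<Union>p \<subseteq> B"
        "\<And>k. k \<in> p \<Longrightarrow> \<exists>u v. u < v \<and> k = {u..v} \<and> 2 / e * (v - u) \<le> norm (F v - F u)"
        "T \<in> lmeasurable" "measure lebesgue T < e/2" "E \<inter> B \<subseteq> \<Union>p \<union> T"
        by (rule finite_Vitali_intervals[OF B, of "\<lambda>u v. 2 / e * (v - u) \<le> norm (F v - F u)"])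
          (erule (1) cover, blast)
      have "measure lebesgue (\<Union>p) \<le> measure lebesgue (ball x (\<delta>/3))"
        using p(3) division_content_sum(1)[OF p(1)] by (intro measure_mono_fmeasurable) (auto simp: B_def)
      also have "\<dots> < \<delta>" using \<delta>(1) by (simp add: ball_eq_greaterThanLessThan)
      finally have "(\<Sum>k\<in>p. norm (F (Sup k) - F (Inf k))) < 1"
        using p(3) division_content_sum(2)[OF p(1)] by (intro \<delta>(2) p(1)) (auto simp: B_def)
      moreover have "(\<Sum>k\<in>p. 2 / e * measure lborel k) \<le> (\<Sum>k\<in>p. norm (F (Sup k) - F (Inf k)))"
        using p(4) by (intro sum_mono) force
      ultimately have "2 / e * measure lebesgue (\<Union>p) < 1"
        using division_content_sum(2)[OF p(1)] by (simp add: sum_distrib_left)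
      then have "measure lebesgue (\<Union>p) < e/2" using e by (simp add: field_simps)
      moreover have "measure lebesgue (\<Union>p \<union> T) \<le> measure lebesgue (\<Union>p) + measure lebesgue T"
        using division_content_sum(1)[OF p(1)] p(5) by (intro measure_Un_le) auto
      ultimately have "measure lebesgue (\<Union>p \<union> T) < e" using p(6) by simp
      then show "\<exists>T. E \<inter> B \<subseteq> T \<and> T \<in> lmeasurable \<and> measure lebesgue T < e"
        using p(5,7) division_content_sum(1)[OF p(1)] by (intro exI[of _ "\<Union>p \<union> T"]) auto
    qed
  qed
qed

text \<open>A single comparison principle that serves for real and imaginary parts, sums, products
  and functions agreeing on the interval.\<close>

lemma abs_cont_on_bound:
  assumes F: "abs_cont_on a b F" and H: "abs_cont_on a b H" and "C > 0"
    and G: "\<And>x y. \<lbrakk>x \<in> {a..b}; y \<in> {a..b}\<rbrakk>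
       \<Longrightarrow> norm (G x - G y) \<le> C * (norm (F x - F y) + norm (H x - H y))"
  shows "abs_cont_on a b G"
  unfolding abs_cont_on_def
proof (intro allI impI)
  fix \<epsilon> :: real assume "\<epsilon> > 0"
  then have e: "\<epsilon> / (2 * C) > 0" using \<open>C > 0\<close> by simp
  let ?Q = "\<lambda>\<delta> n u v. (\<forall>i<n::nat. a \<le> u i \<and> u i \<le> v i \<and> v i \<le> b) \<and>
        disjoint_family_on (\<lambda>i. {u i<..<v i}) {..<n} \<and> (\<Sum>i<n. v i - u i) < (\<delta>::real)"
  obtain d1 where d1: "d1 > 0" "\<forall>n u v. ?Q d1 n u v \<longrightarrow> (\<Sum>i<n. norm (F (v i) - F (u i))) < \<epsilon> / (2 * C)"
    using F[unfolded abs_cont_on_def, rule_format, OF e] by (elim exE conjE)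
  obtain d2 where d2: "d2 > 0" "\<forall>n u v. ?Q d2 n u v \<longrightarrow> (\<Sum>i<n. norm (H (v i) - H (u i))) < \<epsilon> / (2 * C)"
    using H[unfolded abs_cont_on_def, rule_format, OF e] by (elim exE conjE)
  show "\<exists>\<delta>>0. \<forall>n u v. ?Q \<delta> n u v \<longrightarrow> (\<Sum>i<n. norm (G (v i) - G (u i))) < \<epsilon>"
  proof (intro exI[of _ "min d1 d2"] conjI allI impI)
    show "min d1 d2 > 0" using d1 d2 by simp
    fix n u v assume Q: "?Q (min d1 d2) n u v"
    have "(\<Sum>i<n. norm (G (v i) - G (u i)))
        \<le> (\<Sum>i<n. C * (norm (F (v i) - F (u i)) + norm (H (v i) - H (u i))))"
    proof (rule sum_mono)
      fix i assume "i \<in> {..<n}"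
      then have "a \<le> u i" "u i \<le> v i" "v i \<le> b" using Q by auto
      then show "norm (G (v i) - G (u i)) \<le> C * (norm (F (v i) - F (u i)) + norm (H (v i) - H (u i)))"
        by (intro G) auto
    qed
    also have "\<dots> = C * ((\<Sum>i<n. norm (F (v i) - F (u i))) + (\<Sum>i<n. norm (H (v i) - H (u i))))"
      by (simp only: sum_distrib_left[symmetric] sum.distrib)
    also have "\<dots> < C * (\<epsilon> / (2 * C) + \<epsilon> / (2 * C))"
      using d1(2)[rule_format, of n u v] d2(2)[rule_format, of n u v] Q \<open>C > 0\<close>
      by (intro mult_strict_left_mono add_strict_mono) auto
    also have "\<dots> = \<epsilon>" using \<open>C > 0\<close> by (simp add: field_simps)
    finally show "(\<Sum>i<n. norm (G (v i) - G (u i))) < \<epsilon>" .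
  qed
qed

text \<open>A bounded function without a limit oscillates across some gap between rationals.
  Restricting to rational \<open>p\<close> and \<open>q\<close> leaves only countably many
  exceptional sets in the application.\<close>

lemma tendsto_of_rational_gaps:
  fixes \<phi> :: "'a \<Rightarrow> real"
  assumes "F \<noteq> bot" and bd: "\<forall>\<^sub>F y in F. \<bar>\<phi> y\<bar> \<le> n"
    and gap: "\<And>p q. \<lbrakk>p \<in> \<rat>; q \<in> \<rat>; p < q\<rbrakk> \<Longrightarrow> (\<forall>\<^sub>F y in F. p \<le> \<phi> y) \<or> (\<forall>\<^sub>F y in F. \<phi> y \<le> q)"
  shows "\<exists>L. (\<phi> \<longlongrightarrow> L) F"
proof -
  \<comment> \<open>\<open>Sup A\<close> is the lower limit of \<open>\<phi>\<close> along
    \<open>F\<close>.\<close>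
  define A where "A = {p. \<forall>\<^sub>F y in F. p \<le> \<phi> y}"
  have "- n \<in> A" unfolding A_def using bd by simp (erule eventually_mono, simp)
  have ub: "p \<le> n" if "p \<in> A" for p
  proof -
    have "\<forall>\<^sub>F y in F. p \<le> n" using that bd unfolding A_def by simp (erule (1) eventually_elim2, simp)
    then show ?thesis using \<open>F \<noteq> bot\<close> by simp
  qed
  have bdd: "bdd_above A" using ub by (rule bdd_aboveI)
  show ?thesis
  proof (intro exI[of _ "Sup A"] order_tendstoI)
    fix l assume "l < Sup A"
    then obtain p where "p \<in> A" "l < p" using less_cSupE[of l A] \<open>- n \<in> A\<close> by blast
    then show "\<forall>\<^sub>F y in F. l < \<phi> y" unfolding A_def by simp (erule eventually_mono, simp)
  next
    fix l assume l: "Sup A < l"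
    obtain p where p: "p \<in> \<rat>" "Sup A < p" "p < l" using Rats_dense_in_real[OF l] by blast
    obtain q where q: "q \<in> \<rat>" "p < q" "q < l" using Rats_dense_in_real[OF p(3)] by blast
    have "p \<notin> A" using cSup_upper[OF _ bdd, of p] p(2) by auto
    then have "\<forall>\<^sub>F y in F. \<phi> y \<le> q" using gap[OF p(1) q(1,2)] by (auto simp: A_def)
    then show "\<forall>\<^sub>F y in F. \<phi> y < l" by (rule eventually_mono) (use q in simp)
  qed
qed

text \<open>At a point without derivative the difference quotients are either unbounded, which is
  the set \<open>B\<close>, or oscillate across a rational gap, which is some \<open>E p q\<close>.
  Each of these countably many sets is null.\<close>

lemma abs_cont_on_real_differentiable_ae:
  fixes G :: "real \<Rightarrow> real"
  assumes ac: "abs_cont_on a b (\<lambda>x. complex_of_real (G x))"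
  shows "negligible {x \<in> {a<..<b}. \<not> G differentiable (at x)}"
proof -
  define \<phi> where "\<phi> x y = (G y - G x) / (y - x)" for x y
  define E where "E p q = {x \<in> {a<..<b}. (\<exists>\<^sub>F y in at x. \<phi> x y < p) \<and> (\<exists>\<^sub>F y in at x. \<phi> x y > q)}" for p q
  define B where "B = {x \<in> {a<..<b}. \<forall>n>0. \<exists>\<^sub>F y in at x. \<bar>\<phi> x y\<bar> > n}"
  \<comment> \<open>The chord between \<open>x\<close> and \<open>y\<close> spans an interval with
    \<open>x\<close> as one end, on whichever side \<open>y\<close> lies; its slope is the
    difference quotient.\<close>
  have slope: "\<exists>u v. u \<le> x \<and> x \<le> v \<and> u < v \<and> v - u < d \<and> G v - G u = \<phi> x y * (v - u)"
    if "y \<noteq> x" "dist y x < d" for x y d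
    using that by (intro exI[of _ "min x y"] exI[of _ "max x y"])
      (auto simp: \<phi>_def dist_real_def min_def max_def field_simps)
  have neg: "negligible (E p q)" if "p < q" for p q
  proof (rule two_slopes_negligible[OF ac _ that])
    show "E p q \<subseteq> {a<..<b}" by (auto simp: E_def)
    fix x d :: real assume x: "x \<in> E p q" and d: "d > 0"
    have "\<exists>\<^sub>F y in at x. \<phi> x y < p" using x by (simp add: E_def)
    then obtain y where y: "y \<noteq> x" "dist y x < d" "\<phi> x y < p"
      using d unfolding frequently_at by blast
    obtain u v where "u \<le> x" "x \<le> v" "u < v" "v - u < d" "G v - G u = \<phi> x y * (v - u)"
      using slope[OF y(1,2)] by blast
    then show "\<exists>u v. u \<le> x \<and> x \<le> v \<and> u < v \<and> v - u < d \<and> G v - G u \<le> p * (v - u)"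
      using y(3) by (intro exI[of _ u] exI[of _ v]) (auto intro!: mult_right_mono)
    have "\<exists>\<^sub>F y in at x. \<phi> x y > q" using x by (simp add: E_def)
    then obtain y where y: "y \<noteq> x" "dist y x < d" "\<phi> x y > q"
      using d unfolding frequently_at by blast
    obtain u v where "u \<le> x" "x \<le> v" "u < v" "v - u < d" "G v - G u = \<phi> x y * (v - u)"
      using slope[OF y(1,2)] by blast
    then show "\<exists>u v. u \<le> x \<and> x \<le> v \<and> u < v \<and> v - u < d \<and> q * (v - u) \<le> G v - G u"
      using y(3) by (intro exI[of _ u] exI[of _ v]) (auto intro!: mult_right_mono)
  qed
  have negB: "negligible B"
  proof (rule unbounded_slope_negligible[OF ac])
    show "B \<subseteq> {a<..<b}" by (auto simp: B_def)
    fix x d n :: real assume x: "x \<in> B" and d: "d > 0" and n: "n > 0"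
    have "\<exists>\<^sub>F y in at x. \<bar>\<phi> x y\<bar> > n" using x n by (simp add: B_def)
    then obtain y where y: "y \<noteq> x" "dist y x < d" "\<bar>\<phi> x y\<bar> > n"
      using d unfolding frequently_at by blast
    obtain u v where uv: "u \<le> x" "x \<le> v" "u < v" "v - u < d" "G v - G u = \<phi> x y * (v - u)"
      using slope[OF y(1,2)] by blast
    have "n * (v - u) \<le> \<bar>\<phi> x y\<bar> * (v - u)" using uv y by (intro mult_right_mono) auto
    also have "\<dots> = \<bar>G v - G u\<bar>" unfolding uv(5) using uv by (simp add: abs_mult)
    also have "\<dots> = norm (complex_of_real (G v) - complex_of_real (G u))"
      by (simp flip: of_real_diff)
    finally show "\<exists>u v. u \<le> x \<and> x \<le> v \<and> u < v \<and> v - u < d \<and>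
          n * (v - u) \<le> norm (complex_of_real (G v) - complex_of_real (G u))"
      using uv by blast
  qed
  define P where "P = {(p, q). p \<in> \<rat> \<and> q \<in> \<rat> \<and> p < (q::real)}"
  have "countable P" by (rule countable_subset[of _ "\<rat> \<times> \<rat>"]) (auto simp: P_def countable_rat)
  then have negP: "negligible (\<Union>i\<in>P. E (fst i) (snd i))"
    using neg by (intro negligible_countable_Union) (auto simp: P_def)
  have "{x \<in> {a<..<b}. \<not> G differentiable (at x)} \<subseteq> B \<union> (\<Union>i\<in>P. E (fst i) (snd i))"
  proof
    fix x assume x: "x \<in> {x \<in> {a<..<b}. \<not> G differentiable (at x)}"
    show "x \<in> B \<union> (\<Union>i\<in>P. E (fst i) (snd i))"
    proof (rule ccontr)
      assume *: "x \<notin> B \<union> (\<Union>i\<in>P. E (fst i) (snd i))"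
      then obtain n where n: "\<forall>\<^sub>F y in at x. \<bar>\<phi> x y\<bar> \<le> n" 
        using x by (auto simp: B_def not_frequently not_less)
      have "\<exists>L. (\<phi> x \<longlongrightarrow> L) (at x)"
      proof (rule tendsto_of_rational_gaps[OF _ n])
        fix p q :: real assume pq: "p \<in> \<rat>" "q \<in> \<rat>" "p < q"
        then have "(p, q) \<in> P" by (simp add: P_def)
        then have "x \<notin> E p q" using * by force
        then show "(\<forall>\<^sub>F y in at x. p \<le> \<phi> x y) \<or> (\<forall>\<^sub>F y in at x. \<phi> x y \<le> q)"
          using x by (auto simp: E_def not_frequently not_less)
      qed simp
      then obtain L where "(G has_field_derivative L) (at x)"
        unfolding \<phi>_def has_field_derivative_iff by blast
      then show False using x real_differentiable_def by auto
    qed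
  qed
  then show ?thesis by (rule negligible_subset[OF negligible_Un[OF negB negP]])
qed

lemma abs_cont_on_differentiable_ae:
  assumes ac: "abs_cont_on a b F"
  shows "negligible {x \<in> {a<..<b}. \<not> F differentiable (at x)}"
proof -
  have "abs_cont_on a b (\<lambda>x. complex_of_real (Re (F x)))" "abs_cont_on a b (\<lambda>x. complex_of_real (Im (F x)))"
    using abs_Re_le_cmod[of "F x - F y" for x y] abs_Im_le_cmod[of "F x - F y" for x y]
    by (auto intro!: abs_cont_on_bound[OF ac ac zero_less_one] simp flip: of_real_diff)
      (smt (verit) norm_ge_zero)+
  then have N: "negligible ({x \<in> {a<..<b}. \<not> (\<lambda>x. Re (F x)) differentiable (at x)} \<union>
     {x \<in> {a<..<b}. \<not> (\<lambda>x. Im (F x)) differentiable (at x)})"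
    by (intro negligible_Un abs_cont_on_real_differentiable_ae)
  show ?thesis
  proof (rule negligible_subset[OF N], safe)
    fix x assume x: "\<not> F differentiable (at x)" "(\<lambda>x. Im (F x)) differentiable at x"
      "(\<lambda>x. Re (F x)) differentiable at x"
    then obtain D1 D2 where D: "((\<lambda>x. Re (F x)) has_vector_derivative D1) (at x)"
      "((\<lambda>x. Im (F x)) has_vector_derivative D2) (at x)"
      by (auto dest!: vector_derivative_works[THEN iffD1])
    have "((\<lambda>x. complex_of_real (Re (F x)) + \<i> * complex_of_real (Im (F x))) has_vector_derivative
       (of_real D1 + \<i> * of_real D2)) (at x)"
      using D by (intro derivative_intros) (simp_all add: has_real_derivative_iff_has_vector_derivative)
    then show False using x(1) unfolding complex_eq[symmetric]
      by (auto simp: differentiable_def has_vector_derivative_def)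
  qed
qed

text \<open>In a tagged division fine for a suitable gauge, intervals with tag in \<open>N\<close>
  lie in an open set of measure below \<open>\<delta>\<close> and contribute less than
  \<open>\<epsilon>\<close> by absolute continuity. The vanishing derivative bounds the contribution
  of the others by \<open>\<epsilon> * (b - a)\<close>.\<close>

lemma abs_cont_on_zero_derivative:
  assumes ac: "abs_cont_on a b F" and "a \<le> b" and N: "negligible N"
    and der: "\<And>x. x \<in> {a..b} - N \<Longrightarrow> (F has_vector_derivative 0) (at x within {a..b})"
  shows "F b = F a"
proof -
  have "norm (F b - F a) \<le> \<epsilon> * (1 + (b - a))" if e: "\<epsilon> > 0" for \<epsilon>
  proof -
    obtain \<delta> where \<delta>: "\<delta> > 0" "\<And>p. \<lbrakk>p division_of \<Union>p; \<Union>p \<subseteq> {a..b}; sum (measure lborel) p < \<delta>\<rbrakk>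
         \<Longrightarrow> (\<Sum>k\<in>p. norm (F (Sup k) - F (Inf k))) < \<epsilon>"
      using abs_cont_on_division[OF ac e] by blast
    have "N \<in> sets lebesgue" using N negligible_imp_sets by blast
    then obtain U where U: "open U" "N \<subseteq> U" "U - N \<in> lmeasurable" "emeasure lebesgue (U - N) < ennreal \<delta>"
      using sets_lebesgue_outer_open[OF _ \<delta>(1)] by blast
    have Nl: "N \<in> lmeasurable" "measure lebesgue N = 0" 
      using N negligible_imp_measurable negligible_imp_measure0 by auto
    have UN: "U = N \<union> (U - N)" using U by auto
    have Um: "U \<in> lmeasurable" by (subst UN, intro fmeasurable.Un Nl U)
    have "measure lebesgue U \<le> measure lebesgue N + measure lebesgue (U - N)"
      by (subst UN, intro measure_Un_le) (use Nl U in auto)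
    also have "\<dots> < \<delta>" using U \<delta>(1) Nl by (simp add: emeasure_eq_measure2 ennreal_less_iff)
    finally have mU: "measure lebesgue U < \<delta>" .
    \<comment> \<open>The gauge: a ball inside \<open>U\<close> at points of \<open>N\<close>, and
      the radius at which the derivative estimate takes effect at the other points of
      \<open>{a..b}\<close>.\<close>
    have "\<exists>d>0. (x \<in> N \<longrightarrow> ball x d \<subseteq> U) \<and>
        (x \<in> {a..b} - N \<longrightarrow> (\<forall>y\<in>{a..b}. \<bar>y - x\<bar> < d \<longrightarrow> norm (F y - F x) \<le> \<epsilon> * \<bar>y - x\<bar>))" for x
    proof (cases "x \<in> N")
      case True
      then show ?thesis using U(1,2) by (meson Diff_iff openE subsetD)
    next
      case False
      show ?thesis
      proof (cases "x \<in> {a..b}")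
        case True
        with False der have "(F has_derivative (\<lambda>h. h *\<^sub>R 0)) (at x within {a..b})"
          unfolding has_vector_derivative_def by blast
        from this[unfolded has_derivative_within_alt] \<open>\<epsilon> > 0\<close>
        obtain d where "d > 0" "\<forall>y\<in>{a..b}. norm (y - x) < d \<longrightarrow> norm (F y - F x - (y - x) *\<^sub>R 0) \<le> \<epsilon> * norm (y - x)"
          by blast
        then show ?thesis using False by auto
      qed (use False in \<open>auto intro: exI[of _ 1]\<close>)
    qed
    then obtain d where d: "\<And>x. d x > 0" "\<And>x. x \<in> N \<Longrightarrow> ball x (d x) \<subseteq> U"
      "\<And>x y. \<lbrakk>x \<in> {a..b} - N; y \<in> {a..b}; \<bar>y - x\<bar> < d x\<rbrakk> \<Longrightarrow> norm (F y - F x) \<le> \<epsilon> * \<bar>y - x\<bar>"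
      by metis
    obtain p where p: "p tagged_division_of {a..b}" "(\<lambda>x. ball x (d x)) fine p"
      using fine_division_exists_real[OF gauge_ball_dependent, of d] d(1) by blast
    have pk: "\<exists>u v. k = {u..v} \<and> u \<le> x \<and> x \<le> v \<and> a \<le> u \<and> v \<le> b \<and> {u..v} \<subseteq> ball x (d x)" if xk: "(x, k) \<in> p" for x k
    proof -
      obtain u v where uv: "k = {u..v}" using tagged_division_ofD(4)[OF p(1) xk] by auto
      moreover have "x \<in> k" "k \<subseteq> {a..b}" "k \<subseteq> ball x (d x)"
        using tagged_division_ofD(2,3)[OF p(1) xk] p(2) xk by (auto simp: fine_def)
      ultimately show ?thesis by (intro exI[of _ u] exI[of _ v]) auto
    qed
    define p1 where "p1 = {(x, k). (x, k) \<in> p \<and> x \<in> N}"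
    define p2 where "p2 = p - p1"
    have fin: "finite p" using p(1) by blast
    have tp1: "p1 tagged_partial_division_of {a..b}"
      by (rule tagged_partial_division_subset[OF p(1)[unfolded tagged_division_of_def, THEN conjunct1]])
        (simp add: p1_def Collect_mono subset_iff)
    have div1: "snd ` p1 division_of \<Union>(snd ` p1)" by (rule partial_division_of_tagged_division[OF tp1])
    have sub1: "\<Union>(snd ` p1) \<subseteq> U" "\<Union>(snd ` p1) \<subseteq> {a..b}"
      using pk d(2) unfolding p1_def by fastforce+
    have "sum (measure lborel) (snd ` p1) < \<delta>"
      using measure_mono_fmeasurable[OF sub1(1) _ Um] division_content_sum[OF div1] mU
      by (simp add: fmeasurableD)
    then have "(\<Sum>k\<in>snd ` p1. norm (F (Sup k) - F (Inf k))) < \<epsilon>"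
      by (intro \<delta>(2) div1 sub1)
    moreover have "(\<Sum>(x,k)\<in>p1. norm (F (Sup k) - F (Inf k))) = (\<Sum>k\<in>snd ` p1. norm (F (Sup k) - F (Inf k)))"
    proof -
      \<comment> \<open>Two tagged pairs can share an interval only if its interior is empty, and
        then its increment is 0. The empty set is given the value 0 by hand, because
        \<open>Sup\<close> and \<open>Inf\<close> say nothing there.\<close>
      let ?d = "\<lambda>k. if k = {} then 0 else norm (F (Sup k) - F (Inf k))"
      have "(\<Sum>(x,k)\<in>p1. ?d k) = (\<Sum>k\<in>snd ` p1. ?d k)"
        by (rule sum.over_tagged_division_lemma[OF tagged_partial_division_of_Union_self[OF tp1]]) 
          (auto simp: antisym)
      moreover have "(\<Sum>(x,k)\<in>p1. ?d k) = (\<Sum>(x,k)\<in>p1. norm (F (Sup k) - F (Inf k)))"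
        using pk by (intro sum.cong) (force simp: p1_def)+
      moreover have "(\<Sum>k\<in>snd ` p1. ?d k) = (\<Sum>k\<in>snd ` p1. norm (F (Sup k) - F (Inf k)))"
        using division_ofD(3)[OF div1] by (intro sum.cong) simp_all
      ultimately show ?thesis by simp
    qed
    ultimately have 1: "(\<Sum>(x,k)\<in>p1. norm (F (Sup k) - F (Inf k))) < \<epsilon>" by simp
    have "(\<Sum>(x,k)\<in>p2. norm (F (Sup k) - F (Inf k))) \<le> (\<Sum>(x,k)\<in>p2. \<epsilon> * measure lborel k)"
    proof (intro sum_mono, clarify)
      fix x k assume "(x, k) \<in> p2"
      then have xk: "(x, k) \<in> p" "x \<notin> N" by (auto simp: p1_def p2_def)
      obtain u v where uv: "k = {u..v}" "u \<le> x" "x \<le> v" "a \<le> u" "v \<le> b" "{u..v} \<subseteq> ball x (d x)"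
        using pk[OF xk(1)] by blast
      have "u \<in> ball x (d x)" "v \<in> ball x (d x)" by (rule subsetD[OF uv(6)], use uv in simp)+
      then have "\<bar>u - x\<bar> < d x" "\<bar>v - x\<bar> < d x" by (auto simp: dist_real_def)
      then have "norm (F v - F x) \<le> \<epsilon> * \<bar>v - x\<bar>" "norm (F u - F x) \<le> \<epsilon> * \<bar>u - x\<bar>"
        using d(3)[of x v] d(3)[of x u] uv xk by auto
      moreover have "norm (F v - F u) \<le> norm (F v - F x) + norm (F u - F x)"
        by (metis norm_minus_commute norm_triangle_sub dist_norm dist_triangle2)
      ultimately have "norm (F v - F u) \<le> \<epsilon> * (v - u)" using uv by (simp add: algebra_simps)
      then show "norm (F (Sup k) - F (Inf k)) \<le> \<epsilon> * measure lborel k" using uv by simp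
    qed
    also have "\<dots> \<le> (\<Sum>(x,k)\<in>p. \<epsilon> * measure lborel k)"
      using fin e by (intro sum_mono2) (auto simp: p2_def)
    also have "\<dots> = \<epsilon> * (b - a)"
      using additive_content_tagged_division[of p a b] p(1) \<open>a \<le> b\<close>
      by (simp add: sum_distrib_left[symmetric] case_prod_unfold)
    finally have 2: "(\<Sum>(x,k)\<in>p2. norm (F (Sup k) - F (Inf k))) \<le> \<epsilon> * (b - a)" .
    have "norm (F b - F a) = norm (\<Sum>(x,k)\<in>p. F (Sup k) - F (Inf k))"
      using additive_tagged_division_1[OF \<open>a \<le> b\<close> p(1), of F] by simp
    also have "\<dots> \<le> (\<Sum>(x,k)\<in>p. norm (F (Sup k) - F (Inf k)))"
      by (rule order_trans[OF norm_sum]) (simp add: case_prod_unfold)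
    also have "\<dots> = (\<Sum>(x,k)\<in>p2. norm (F (Sup k) - F (Inf k))) + (\<Sum>(x,k)\<in>p1. norm (F (Sup k) - F (Inf k)))"
      unfolding p2_def using fin by (intro sum.subset_diff) (auto simp: p1_def)
    also have "\<dots> \<le> \<epsilon> * (b - a) + \<epsilon>" using 1 2 by simp
    finally show ?thesis by (simp add: algebra_simps)
  qed
  then have "norm (F b - F a) / (1 + (b - a)) \<le> \<epsilon>" if "\<epsilon> > 0" for \<epsilon>
    using that \<open>a \<le> b\<close> by (simp add: divide_le_eq)
  then have "norm (F b - F a) / (1 + (b - a)) \<le> 0" by (rule field_le_epsilon[of _ 0, simplified])
  then show ?thesis using \<open>a \<le> b\<close> by (simp add: divide_le_0_iff)
qed

section \<open>Locally absolutely continuous functions on the interval\<close>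

lemma abs_cont_on_continuous:
  assumes F: "abs_cont_on a b F"
  shows "continuous_on {a..b} F"
proof (rule continuous_onI)
  fix x e :: real assume x: "x \<in> {a..b}" and e: "e > 0"
  obtain d where d: "d > 0" "\<And>p. \<lbrakk>p division_of \<Union>p; \<Union>p \<subseteq> {a..b}; sum (measure lborel) p < d\<rbrakk>
       \<Longrightarrow> (\<Sum>k\<in>p. norm (F (Sup k) - F (Inf k))) < e"
    using abs_cont_on_division[OF F e] by blast
  show "\<exists>d>0. \<forall>y\<in>{a..b}. dist y x < d \<longrightarrow> dist (F y) (F x) \<le> e"
  proof (intro exI[of _ d] conjI ballI impI d(1))
    fix y assume y: "y \<in> {a..b}" "dist y x < d"
    \<comment> \<open>The division consists of the single interval between \<open>x\<close> and
      \<open>y\<close>.\<close>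
    have "(\<Sum>k\<in>{{min x y..max x y}}. norm (F (Sup k) - F (Inf k))) < e"
    proof (rule d(2))
      show "{{min x y..max x y}} division_of \<Union>{{min x y..max x y}}"
        using division_of_self[of "min x y" "max x y"] by (simp add: box_real)
    qed (use x y in \<open>auto simp: dist_real_def\<close>)
    then show "dist (F y) (F x) \<le> e"
      by (auto simp: dist_norm norm_minus_commute min_def max_def split: if_splits)
  qed
qed

lemma abs_cont_on_Lipschitz:
  assumes "\<And>x y. \<lbrakk>x \<in> {a..b}; y \<in> {a..b}\<rbrakk> \<Longrightarrow> norm (F x - F y) \<le> C * \<bar>x - y\<bar>"
  shows "abs_cont_on a b F"
  unfolding abs_cont_on_def
proof (intro allI impI)
  fix \<epsilon> :: real assume "\<epsilon> > 0"
  let ?Q = "\<lambda>\<delta> n u v. (\<forall>i<n::nat. a \<le> u i \<and> u i \<le> v i \<and> v i \<le> b) \<and>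
        disjoint_family_on (\<lambda>i. {u i<..<v i}) {..<n} \<and> (\<Sum>i<n. v i - u i) < (\<delta>::real)"
  show "\<exists>\<delta>>0. \<forall>n u v. ?Q \<delta> n u v \<longrightarrow> (\<Sum>i<n. norm (F (v i) - F (u i))) < \<epsilon>"
  \<comment> \<open>The constant \<open>C\<close> may be 0, so \<open>\<bar>C\<bar> + 1\<close>
    serves as the Lipschitz constant and keeps the denominator positive.\<close>
  proof (intro exI[of _ "\<epsilon> / (\<bar>C\<bar> + 1)"] conjI allI impI)
    show "\<epsilon> / (\<bar>C\<bar> + 1) > 0" using \<open>\<epsilon> > 0\<close> by simp
    fix n u v assume Q: "?Q (\<epsilon> / (\<bar>C\<bar> + 1)) n u v"
    have "(\<Sum>i<n. norm (F (v i) - F (u i))) \<le> (\<Sum>i<n. (\<bar>C\<bar> + 1) * (v i - u i))"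
    proof (rule sum_mono)
      fix i assume "i \<in> {..<n}"
      then have i: "a \<le> u i" "u i \<le> v i" "v i \<le> b" using Q by auto
      then have "norm (F (v i) - F (u i)) \<le> C * \<bar>v i - u i\<bar>"
        by (intro assms) auto
      also have "\<dots> \<le> (\<bar>C\<bar> + 1) * \<bar>v i - u i\<bar>" by (intro mult_right_mono) auto
      finally show "norm (F (v i) - F (u i)) \<le> (\<bar>C\<bar> + 1) * (v i - u i)" using i by simp
    qed
    also have "\<dots> = (\<bar>C\<bar> + 1) * (\<Sum>i<n. v i - u i)"
      by (simp only: sum_distrib_left)
    also have "\<dots> < (\<bar>C\<bar> + 1) * (\<epsilon> / (\<bar>C\<bar> + 1))"
      using Q by (intro mult_strict_left_mono) auto
    also have "\<dots> = \<epsilon>" by (simp add: add_nonneg_pos[THEN less_imp_neq, symmetric])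
    finally show "(\<Sum>i<n. norm (F (v i) - F (u i))) < \<epsilon>" .
  qed
qed

lemma abs_cont_on_C1:
  assumes der: "\<And>x. x \<in> {a..b} \<Longrightarrow> (F has_vector_derivative F' x) (at x within {a..b})"
    and cont: "continuous_on {a..b} F'"
  shows "abs_cont_on a b F"
proof -
  obtain C where C: "\<And>x. x \<in> {a..b} \<Longrightarrow> norm (F' x) \<le> C"
    using compact_imp_bounded[OF compact_continuous_image[OF cont compact_Icc]]
    by (force simp: bounded_iff)
  show ?thesis
  proof (rule abs_cont_on_Lipschitz)
    fix x y assume "x \<in> {a..b}" "y \<in> {a..b}"
    moreover have "(F has_derivative (\<lambda>h. h *\<^sub>R F' x)) (at x within {a..b})" if "x \<in> {a..b}" for x
      using der[OF that] by (simp add: has_vector_derivative_def)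
    moreover have "onorm (\<lambda>h. h *\<^sub>R F' x) \<le> C" if "x \<in> {a..b}" for x
      by (rule onorm_le) (metis C[OF that] abs_ge_zero mult.commute mult_left_mono norm_scaleR real_norm_def)
    ultimately have "norm (F x - F y) \<le> C * norm (x - y)"
      by (intro differentiable_bound[of "{a..b}" F "\<lambda>x h. h *\<^sub>R F' x" C]) auto
    then show "norm (F x - F y) \<le> C * \<bar>x - y\<bar>" by simp
  qed
qed

section \<open>Closure properties of absolute continuity, globally and locally\<close>

lemma abs_cont_on_add:
  assumes "abs_cont_on a b F" "abs_cont_on a b G"
  shows "abs_cont_on a b (\<lambda>x. F x + G x)"
  by (rule abs_cont_on_bound[OF assms zero_less_one])
     (simp add: add_diff_add norm_triangle_ineq)

lemma abs_cont_on_mult: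
  assumes F: "abs_cont_on a b F" and G: "abs_cont_on a b G"
  shows "abs_cont_on a b (\<lambda>x. F x * G x)"
proof -
  have "\<exists>C. \<forall>x\<in>{a..b}. norm (H x) \<le> C" if "abs_cont_on a b H" for H
    using compact_imp_bounded[OF compact_continuous_image[OF abs_cont_on_continuous[OF that] compact_Icc]]
    by (auto simp: bounded_iff)
  then obtain A B where A: "\<And>x. x \<in> {a..b} \<Longrightarrow> norm (F x) \<le> A" and B: "\<And>x. x \<in> {a..b} \<Longrightarrow> norm (G x) \<le> B"
    using F G by metis
  define C where "C = max 1 (max A B)"
  show ?thesis
  proof (rule abs_cont_on_bound[OF F G])
    show "C > 0" by (auto simp: C_def)
    fix x y assume xy: "x \<in> {a..b}" "y \<in> {a..b}"
    have "F x * G x - F y * G y = (F x - F y) * G x + F y * (G x - G y)" by (simp add: algebra_simps)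
    also have "norm \<dots> \<le> norm (F x - F y) * norm (G x) + norm (F y) * norm (G x - G y)"
      by (metis norm_mult norm_triangle_ineq)
    also have "\<dots> \<le> norm (F x - F y) * C + C * norm (G x - G y)"
      using A[OF xy(2)] B[OF xy(1)] by (intro add_mono mult_mono) (auto simp: C_def)
    finally show "norm (F x * G x - F y * G y) \<le> C * (norm (F x - F y) + norm (G x - G y))"
      by (simp add: algebra_simps)
  qed
qed

lemma abs_cont_on_cong:
  assumes "\<And>x. x \<in> {a..b} \<Longrightarrow> F x = G x" "abs_cont_on a b F"
  shows "abs_cont_on a b G"
  by (rule abs_cont_on_bound[OF assms(2) assms(2) zero_less_one]) (simp add: assms(1)[symmetric])

lemma AC_loc_cong: "\<lbrakk>\<And>x. x \<in> Iop \<Longrightarrow> F x = G x; F \<in> AC_loc\<rbrakk> \<Longrightarrow> G \<in> AC_loc"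
  unfolding AC_loc_def by (auto intro: abs_cont_on_cong[of _ _ F])

lemma AC_loc_add: "\<lbrakk>F \<in> AC_loc; G \<in> AC_loc\<rbrakk> \<Longrightarrow> (\<lambda>x. F x + G x) \<in> AC_loc"
  unfolding AC_loc_def by (auto intro: abs_cont_on_add)

lemma AC_loc_mult: "\<lbrakk>F \<in> AC_loc; G \<in> AC_loc\<rbrakk> \<Longrightarrow> (\<lambda>x. F x * G x) \<in> AC_loc"
  unfolding AC_loc_def by (auto intro: abs_cont_on_mult)

lemma AC_loc_C1:
  assumes "\<And>x. x \<in> Iop \<Longrightarrow> (F has_vector_derivative F' x) (at x)" "continuous_on Iop F'"
  shows "F \<in> AC_loc"
  unfolding AC_loc_def
proof (clarify)
  fix a b :: real assume ab: "-1 < a" "a \<le> b" "b < 1"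
  show "abs_cont_on a b F"
    by (rule abs_cont_on_C1[of _ _ _ F'])
      (use ab in \<open>auto intro!: has_vector_derivative_at_within assms continuous_on_subset[OF assms(2)]\<close>)
qed

text \<open>Meant for the polynomial coefficients and for \<open>1 / (1 - x\<^sup>2)\<close>, all
  continuously differentiable on the open interval.\<close>

lemma AC_loc_scaleR_C1:
  fixes c c' :: "real \<Rightarrow> real"
  assumes c: "\<And>x. x \<in> Iop \<Longrightarrow> (c has_real_derivative c' x) (at x)" "continuous_on Iop c'" and F: "F \<in> AC_loc"
  shows "(\<lambda>x. c x *\<^sub>R F x) \<in> AC_loc"
proof -
  have "(\<lambda>x. complex_of_real (c x)) \<in> AC_loc"
  proof (rule AC_loc_C1)
    show "((\<lambda>x. complex_of_real (c x)) has_vector_derivative complex_of_real (c' x)) (at x)" if "x \<in> Iop" for x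
      using c(1)[OF that] by (intro has_vector_derivative_of_real) (simp add: has_real_derivative_iff_has_vector_derivative)
  qed (intro continuous_intros c)
  then show ?thesis using AC_loc_mult[OF _ F] by (simp add: scaleR_conv_of_real)
qed

lemma AC_loc_diff: "\<lbrakk>F \<in> AC_loc; G \<in> AC_loc\<rbrakk> \<Longrightarrow> (\<lambda>x. F x - G x) \<in> AC_loc"
  using AC_loc_add[of F "\<lambda>x. (-1) *\<^sub>R G x"] AC_loc_scaleR_C1[of "\<lambda>_. -1" "\<lambda>_. 0" G] by simp

lemma AC_loc_continuous: "F \<in> AC_loc \<Longrightarrow> continuous_on Iop F"
proof (rule continuous_at_imp_continuous_on, rule ballI)
  fix x assume F: "F \<in> AC_loc" and x: "x \<in> Iop"
  \<comment> \<open>The end points lie halfway between \<open>x\<close> and -1 and halfway between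
    \<open>x\<close> and 1, so \<open>x\<close> is interior to a compact subinterval.\<close>
  have "continuous_on {(x - 1)/2..(x+1)/2} F"
    using F x by (intro abs_cont_on_continuous) (auto simp: AC_loc_def)
  moreover have "x \<in> interior {(x - 1)/2..(x+1)/2}" using x by (auto simp: interior_atLeastAtMost_real field_simps)
  ultimately show "isCont F x" by (rule continuous_on_interior)
qed

lemma AC_loc_differentiable_ae:
  assumes F: "F \<in> AC_loc"
  shows "negligible {x \<in> Iop. \<not> F differentiable (at x)}"
proof -
  \<comment> \<open>Countably many intervals with closure inside (-1,1) exhaust it; the first one is
    (-1/2, 1/2).\<close>
  have "negligible (\<Union>n. {x \<in> {-1 + 1 / real (Suc (Suc n))<..<1 - 1 / real (Suc (Suc n))}. \<not> F differentiable (at x)})"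
  proof (rule negligible_Union_nat)
    fix n show "negligible {x \<in> {-1 + 1 / real (Suc (Suc n))<..<1 - 1 / real (Suc (Suc n))}. \<not> F differentiable (at x)}"
      using F by (intro abs_cont_on_differentiable_ae) (auto simp: AC_loc_def field_simps)
  qed
  moreover have "{x \<in> Iop. \<not> F differentiable (at x)} \<subseteq> 
     (\<Union>n. {x \<in> {-1 + 1 / real (Suc (Suc n))<..<1 - 1 / real (Suc (Suc n))}. \<not> F differentiable (at x)})"
  proof clarify
    fix x assume x: "x \<in> Iop" "\<not> F differentiable (at x)"
    then have "1 - \<bar>x\<bar> > 0" by auto
    then obtain n where n: "n \<noteq> 0" "1 / real n < 1 - \<bar>x\<bar>" by (metis real_arch_invD inverse_eq_divide)
    have "1 / real (Suc (Suc n)) \<le> 1 / real n" using n by (intro divide_left_mono) auto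
    then have "x \<in> {-1 + 1 / real (Suc (Suc n))<..<1 - 1 / real (Suc (Suc n))}" using n by auto
    then show "x \<in> (\<Union>n. {x \<in> {-1 + 1 / real (Suc (Suc n))<..<1 - 1 / real (Suc (Suc n))}. \<not> F differentiable (at x)})"
      using x by blast
  qed
  ultimately show ?thesis by (rule negligible_subset)
qed

lemma AE_Iop_negligible:
  assumes "negligible {x \<in> Iop. \<not> P x}"
  shows "AE x in lebesgue_on Iop. P x"
proof -
  have "AE x in lebesgue. x \<in> Iop \<longrightarrow> P x"
    by (rule AE_I'[of "{x \<in> Iop. \<not> P x}"]) (use assms negligible_iff_null_sets in auto)
  then show ?thesis by (subst AE_restrict_space_iff) auto
qed

section \<open>Calculus of the total derivative \<open>D\<close> on the open interval\<close>

lemma D_eq: "(f has_vector_derivative d) (at x) \<Longrightarrow> D f x = d"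
  by (simp add: D_def vector_derivative_at)

lemma has_vector_derivative_cong_Iop:
  "\<lbrakk>x \<in> Iop; \<And>y. y \<in> Iop \<Longrightarrow> f y = g y\<rbrakk> \<Longrightarrow> (f has_vector_derivative d) (at x) = (g has_vector_derivative d) (at x)"
  using has_vector_derivative_transform_within_open[of f d x Iop g]
    has_vector_derivative_transform_within_open[of g d x Iop f] by auto

text \<open>Valid also where no derivative exists: \<open>vector_derivative\<close> then makes its
  choice from the same predicate for both functions.\<close>

lemma D_cong: "\<lbrakk>x \<in> Iop; \<And>y. y \<in> Iop \<Longrightarrow> f y = g y\<rbrakk> \<Longrightarrow> D f x = D g x"
  unfolding D_def vector_derivative_def using has_vector_derivative_cong_Iop[of x f g] by presburger

lemma differentiable_D: "f differentiable (at x) \<Longrightarrow> (f has_vector_derivative D f x) (at x)"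
  by (simp add: D_def vector_derivative_works)

lemma has_vector_derivative_differentiable: "(f has_vector_derivative d) (at x) \<Longrightarrow> f differentiable (at x)"
  by (auto simp: differentiable_def has_vector_derivative_def)

text \<open>Only the highest derivative needs checking, since a function with a continuous
  derivative is locally absolutely continuous. The third-order version below descends in the same
  way.\<close>

lemma AC_loc_upto_1: "f \<in> AC_loc_upto 1 \<longleftrightarrow>
    (\<forall>x\<in>Iop. (f has_vector_derivative D f x) (at x)) \<and> D f \<in> AC_loc"
proof
  assume "f \<in> AC_loc_upto 1"
  then have "\<forall>x\<in>Iop. (D ^^ 0) f differentiable (at x)" "(D ^^ 1) f \<in> AC_loc"
    unfolding AC_loc_upto_def by blast+
  then show "(\<forall>x\<in>Iop. (f has_vector_derivative D f x) (at x)) \<and> D f \<in> AC_loc"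
    by (simp add: differentiable_D)
next
  assume *: "(\<forall>x\<in>Iop. (f has_vector_derivative D f x) (at x)) \<and> D f \<in> AC_loc"
  then have "f \<in> AC_loc" by (intro AC_loc_C1[of _ "D f"]) (auto intro: AC_loc_continuous)
  with * show "f \<in> AC_loc_upto 1"
    by (auto simp: AC_loc_upto_def le_Suc_eq has_vector_derivative_differentiable)
qed

lemma AC_loc_upto_3: "f \<in> AC_loc_upto 3 \<longleftrightarrow>
    (\<forall>x\<in>Iop. (f has_vector_derivative D f x) (at x)) \<and>
    (\<forall>x\<in>Iop. (D f has_vector_derivative D (D f) x) (at x)) \<and>
    (\<forall>x\<in>Iop. (D (D f) has_vector_derivative D (D (D f)) x) (at x)) \<and> D (D (D f)) \<in> AC_loc"
  (is "_ \<longleftrightarrow> ?R")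
proof
  assume "f \<in> AC_loc_upto 3"
  then have "\<forall>j<3. \<forall>x\<in>Iop. (D ^^ j) f differentiable (at x)" "\<forall>j\<le>3. (D ^^ j) f \<in> AC_loc"
    unfolding AC_loc_upto_def by blast+
  then have "\<forall>x\<in>Iop. (D ^^ 0) f differentiable (at x)" "\<forall>x\<in>Iop. (D ^^ Suc 0) f differentiable (at x)"
    "\<forall>x\<in>Iop. (D ^^ Suc (Suc 0)) f differentiable (at x)" "(D ^^ Suc (Suc (Suc 0))) f \<in> AC_loc"
    by (auto simp only: numeral_3_eq_3 less_Suc_eq le_Suc_eq)
  then show ?R by (simp add: differentiable_D)
next
  assume R: ?R
  then have 2: "D (D f) \<in> AC_loc" by (intro AC_loc_C1[of _ "D (D (D f))"]) (auto intro: AC_loc_continuous)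
  with R have 1: "D f \<in> AC_loc" by (intro AC_loc_C1[of _ "D (D f)"]) (auto intro: AC_loc_continuous)
  with R have 0: "f \<in> AC_loc" by (intro AC_loc_C1[of _ "D f"]) (auto intro: AC_loc_continuous)
  show "f \<in> AC_loc_upto 3" using R 0 1 2
    by (auto simp: AC_loc_upto_def le_Suc_eq less_Suc_eq numeral_3_eq_3 has_vector_derivative_differentiable)
qed

section \<open>Growth at the end points\<close>

text \<open>Completeness of Lebesgue measure carries measurability over to \<open>v\<close>, after
  extension by zero to the whole line.\<close>

lemma L2_cong_AE:
  assumes u: "u \<in> L2" and uv: "AE x in lebesgue_on Iop. u x = v x"
  shows "v \<in> L2"
proof -
  have "AE x in lebesgue. x \<in> Iop \<longrightarrow> u x = v x"
    using uv by (subst (asm) AE_restrict_space_iff) auto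
  then have "AE x in lebesgue. (if x \<in> Iop then u x else 0) = (if x \<in> Iop then v x else 0)"
    by (rule AE_mp) simp
  moreover have "(\<lambda>x. if x \<in> Iop then u x else 0) \<in> borel_measurable lebesgue"
    using u by (subst borel_measurable_if) (auto simp: L2_def)
  ultimately have "(\<lambda>x. if x \<in> Iop then v x else 0) \<in> borel_measurable lebesgue"
    by (rule borel_measurable_AE[rotated])
  then have v: "v \<in> borel_measurable (lebesgue_on Iop)"
    by (subst (asm) borel_measurable_if) auto
  have "integrable (lebesgue_on Iop) (\<lambda>x. (norm (u x))\<^sup>2)" using u by (simp add: L2_def)
  then have "integrable (lebesgue_on Iop) (\<lambda>x. (norm (v x))\<^sup>2)"
    by (subst integrable_cong_AE[of _ _ "\<lambda>x. (norm (u x))\<^sup>2"]) (use u v uv in \<open>auto simp: L2_def\<close>)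
  then show ?thesis using v by (simp add: L2_def)
qed

text \<open>Only values near the ends matter. Leaving out 0 allows a later division by
  \<open>x\<close>.\<close>

lemma lim_ends_zero_cong:
  assumes "lim_ends_zero u" "\<And>x. \<lbrakk>x \<in> Iop; x \<noteq> 0\<rbrakk> \<Longrightarrow> u x = v x"
  shows "lim_ends_zero v"
proof -
  have "\<forall>\<^sub>F x in at_left 1. u x = v x" "\<forall>\<^sub>F x in at_right (-1). u x = v x"
    using eventually_at_left_real[of 0 "1::real"] eventually_at_right_real[of "-1" "0::real"]
    by (auto elim!: eventually_mono intro: assms(2))
  then show ?thesis using assms(1) unfolding lim_ends_zero_def by (auto simp: tendsto_cong)
qed

lemma lim_ends_zero_add: "\<lbrakk>lim_ends_zero u; lim_ends_zero v\<rbrakk> \<Longrightarrow> lim_ends_zero (\<lambda>x. u x + v x)"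
  unfolding lim_ends_zero_def by (auto intro: tendsto_add_zero)

lemma lim_ends_zero_scaleR:
  assumes "lim_ends_zero u" "(c \<longlongrightarrow> c1) (at_left 1)" "(c \<longlongrightarrow> c2) (at_right (-1))"
  shows "lim_ends_zero (\<lambda>x. c x *\<^sub>R u x)"
  using assms tendsto_scaleR[of c c1 "at_left 1" u 0] tendsto_scaleR[of c c2 "at_right (-1)" u 0]
  unfolding lim_ends_zero_def by simp

lemma lim_ends_zero_bounded:
  assumes u: "lim_ends_zero u" and cont: "continuous_on Iop u"
  obtains C where "\<And>x. x \<in> Iop \<Longrightarrow> norm (u x) \<le> C"
proof -
  have "\<forall>\<^sub>F x in at_left 1. norm (u x) < 1" "\<forall>\<^sub>F x in at_right (-1). norm (u x) < 1"
    using u order_tendstoD(2)[OF tendsto_norm_zero zero_less_one] unfolding lim_ends_zero_def by blast+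
  then obtain a b where ab: "a > -1" "\<And>x. \<lbrakk>-1 < x; x < a\<rbrakk> \<Longrightarrow> norm (u x) < 1" 
      "b < 1" "\<And>x. \<lbrakk>b < x; x < 1\<rbrakk> \<Longrightarrow> norm (u x) < 1"
    unfolding eventually_at_left_field eventually_at_right_field by blast
  \<comment> \<open>If \<open>b < a\<close>, the middle interval is empty and the two end regions
    already cover everything.\<close>
  have "continuous_on {a..b} u" using ab by (intro continuous_on_subset[OF cont]) auto
  then have "bounded (u ` {a..b})" by (intro compact_imp_bounded compact_continuous_image compact_Icc)
  then obtain C where C: "\<And>x. x \<in> {a..b} \<Longrightarrow> norm (u x) \<le> C" by (force simp: bounded_iff)
  show thesis
  proof (rule that[of "max 1 C"])
    fix x assume x: "x \<in> Iop"
    then consider "x < a" | "x > b" | "x \<in> {a..b}" by fastforce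
    then show "norm (u x) \<le> max 1 C" using ab C x by cases (force simp: le_max_iff_disj)+
  qed
qed

section \<open>Consequences of a bounded \<open>(1 - x\<^sup>2) h'\<close>\<close>

lemma one_minus_square_pos: "x \<in> Iop \<Longrightarrow> 0 < 1 - x\<^sup>2"
  by (simp add: abs_square_less_1 abs_less_iff)

text \<open>The primitive \<open>2 x (1 - x\<^sup>2)\<^sup>-\<^sup>1\<^sup>/\<^sup>4\<close> dominates that of \<open>1 / (1 - x\<^sup>2)\<close>, so it
  absorbs the logarithm produced by a bounded \<open>(1 - x\<^sup>2) h'\<close>.\<close>

lemma growth_majorant:
  assumes x: "x \<in> Iop"
  shows "((\<lambda>x. 2 * x * (1 - x\<^sup>2) powr (-1/4)) has_real_derivative
      (2 - x\<^sup>2) * (1 - x\<^sup>2) powr (-5/4)) (at x)"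
    and "1 / (1 - x\<^sup>2) \<le> (2 - x\<^sup>2) * (1 - x\<^sup>2) powr (-5/4)"
proof -
  let ?p = "1 - x\<^sup>2"
  have p: "0 < ?p" "?p \<le> 1" using one_minus_square_pos[OF x] by auto
  have e: "?p powr (-1/4) = ?p * ?p powr (-5/4)" using p powr_add[of ?p 1 "-5/4"] by simp
  show "((\<lambda>x. 2 * x * (1 - x\<^sup>2) powr (-1/4)) has_real_derivative
      (2 - x\<^sup>2) * (1 - x\<^sup>2) powr (-5/4)) (at x)"
  proof -
    have "((\<lambda>x. 2 * x * (1 - x\<^sup>2) powr (-1/4)) has_real_derivative
        2 * ?p powr (-1/4) + 2 * x * (-1/4 * ?p powr (-5/4) * (- 2 * x))) (at x)"
      using p by (auto intro!: derivative_eq_intros)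
    also have "2 * ?p powr (-1/4) + 2 * x * (-1/4 * ?p powr (-5/4) * (- 2 * x)) = (2 - x\<^sup>2) * ?p powr (-5/4)"
      unfolding e by (simp add: algebra_simps power2_eq_square)
    finally show ?thesis .
  qed
  have "1 / ?p = ?p powr (-1)" using p by (simp add: powr_minus divide_inverse)
  also have "\<dots> \<le> ?p powr (-5/4)" using p by (intro powr_mono') auto
  also have "\<dots> \<le> (2 - x\<^sup>2) * ?p powr (-5/4)" using p by simp
  finally show "1 / ?p \<le> (2 - x\<^sup>2) * ?p powr (-5/4)" .
qed

text \<open>The mean value inequality applied from 0 in both directions; the absolute value covers
  negative \<open>x\<close>, where \<open>\<psi> x - \<psi> 0\<close> is nonpositive.\<close>

lemma norm_diff_origin_le:
  fixes h :: "real \<Rightarrow> complex" and \<psi> :: "real \<Rightarrow> real"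
  assumes h: "\<And>x. x \<in> Iop \<Longrightarrow> (h has_vector_derivative h' x) (at x)"
    and \<psi>: "\<And>x. x \<in> Iop \<Longrightarrow> (\<psi> has_real_derivative \<psi>' x) (at x)"
    and le: "\<And>x. x \<in> Iop \<Longrightarrow> norm (h' x) \<le> \<psi>' x" and x: "x \<in> Iop"
  shows "norm (h x - h 0) \<le> \<bar>\<psi> x - \<psi> 0\<bar>"
proof -
  have *: "norm (h b - h a) \<le> \<psi> b - \<psi> a" if ab: "a < b" "a \<in> Iop" "b \<in> Iop" for a b
  proof (rule differentiable_bound_general[OF ab(1), where f' = h' and \<phi>' = \<psi>'])
    have "isCont h y" "isCont \<psi> y" if "y \<in> {a..b}" for y
      using h[of y] \<psi>[of y] that ab by (auto intro: has_vector_derivative_continuous DERIV_isCont)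
    then show "continuous_on {a..b} h" "continuous_on {a..b} \<psi>"
      by (auto intro: continuous_at_imp_continuous_on)
  qed (use ab in \<open>auto intro!: h \<psi> le simp flip: has_real_derivative_iff_has_vector_derivative\<close>)
  consider "x < 0" | "x = 0" | "x > 0" by linarith
  then show ?thesis
    using *[of x 0] *[of 0 x] x by cases (auto simp: norm_minus_commute)
qed

text \<open>Integrating the bound on \<open>h'\<close> from 0 gives growth below the majorant. The
  exponent -1/4 is small enough for square integrability and for multiplication by
  \<open>1 - x\<^sup>2\<close> to give limit 0 at the ends.\<close>

lemma growth_bound:
  fixes h :: "real \<Rightarrow> complex"
  assumes h: "\<And>x. x \<in> Iop \<Longrightarrow> (h has_vector_derivative h' x) (at x)"
    and C: "\<And>x. x \<in> Iop \<Longrightarrow> norm ((1 - x\<^sup>2) *\<^sub>R h' x) \<le> C"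
  obtains K where "K \<ge> 0" "\<And>x. x \<in> Iop \<Longrightarrow> norm (h x) \<le> K * (1 - x\<^sup>2) powr (-1/4)"
proof
  have C0: "C \<ge> 0" using order_trans[OF norm_ge_zero C[of 0]] by simp
  show "norm (h 0) + 2 * C \<ge> 0" using C0 by simp
  fix x assume x: "x \<in> Iop"
  let ?q = "(1 - x\<^sup>2) powr (-1/4)"
  \<comment> \<open>This absorbs the constant \<open>norm (h 0)\<close> into the power.\<close>
  have q: "1 \<le> ?q" using one_minus_square_pos[OF x] powr_mono'[of "-1/4" 0 "1 - x\<^sup>2"] by simp
  have "norm (h x - h 0) \<le> \<bar>C * (2 * x * ?q) - C * (2 * 0 * (1 - 0\<^sup>2) powr (-1/4))\<bar>"
  proof (rule norm_diff_origin_le[OF h _ _ x])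
    fix y :: real assume y: "y \<in> Iop"
    show "((\<lambda>x. C * (2 * x * (1 - x\<^sup>2) powr (-1/4))) has_real_derivative C * ((2 - y\<^sup>2) * (1 - y\<^sup>2) powr (-5/4))) (at y)"
      by (rule DERIV_cmult[OF growth_majorant(1)[OF y]])
    have "norm (h' y) \<le> C * (1 / (1 - y\<^sup>2))"
      using C[OF y] one_minus_square_pos[OF y] by (simp add: pos_le_divide_eq mult.commute)
    also have "\<dots> \<le> C * ((2 - y\<^sup>2) * (1 - y\<^sup>2) powr (-5/4))"
      using growth_majorant(2)[OF y] C0 by (rule mult_left_mono)
    finally show "norm (h' y) \<le> C * ((2 - y\<^sup>2) * (1 - y\<^sup>2) powr (-5/4))" .
  qed
  also have "\<dots> = 2 * C * \<bar>x\<bar> * ?q" using C0 by (simp add: abs_mult)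
  also have "\<dots> \<le> 2 * C * 1 * ?q" using x C0 by (intro mult_right_mono mult_left_mono) auto
  finally have "norm (h x) \<le> norm (h 0) * 1 + 2 * C * ?q"
    using norm_triangle_sub[of "h x" "h 0"] by simp
  also have "\<dots> \<le> norm (h 0) * ?q + 2 * C * ?q" using q by (intro add_right_mono mult_left_mono) auto
  finally show "norm (h x) \<le> (norm (h 0) + 2 * C) * ?q" by (simp add: algebra_simps)
qed

text \<open>The product is dominated by a multiple of the power 3/4 of \<open>1 - x\<^sup>2\<close>,
  which tends to 0.\<close>

lemma growth_lim_ends_zero:
  assumes h: "\<And>x. x \<in> Iop \<Longrightarrow> norm (h x) \<le> K * (1 - x\<^sup>2) powr (-1/4)"
  shows "lim_ends_zero (\<lambda>x. (1 - x\<^sup>2) *\<^sub>R h x)"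
proof -
  have b: "norm ((1 - x\<^sup>2) *\<^sub>R h x) \<le> K * (1 - x\<^sup>2) powr (3/4)" if x: "x \<in> Iop" for x
  proof -
    have "norm ((1 - x\<^sup>2) *\<^sub>R h x) = (1 - x\<^sup>2) * norm (h x)" using one_minus_square_pos[OF x] by simp
    also have "\<dots> \<le> (1 - x\<^sup>2) * (K * (1 - x\<^sup>2) powr (-1/4))"
      using h[OF x] one_minus_square_pos[OF x] by (intro mult_left_mono) auto
    also have "\<dots> = K * (1 - x\<^sup>2) powr (3/4)"
      using one_minus_square_pos[OF x] powr_add[of "1 - x\<^sup>2" 1 "-1/4"] by simp
    finally show ?thesis .
  qed
  have ev: "\<forall>\<^sub>F x in at_left 1. x \<in> Iop" "\<forall>\<^sub>F x in at_right (-1). x \<in> Iop"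
    using eventually_at_left_real[of "-1" "1::real"] eventually_at_right_real[of "-1" "1::real"] by auto
  have lim: "((\<lambda>x. K * (1 - x\<^sup>2) powr (3/4)) \<longlongrightarrow> 0) F" 
    if F: "\<forall>\<^sub>F x in F. x \<in> Iop" "((\<lambda>x::real. 1 - x\<^sup>2) \<longlongrightarrow> 0) F" for F
    by (rule tendsto_mult_right_zero, rule tendsto_zero_powrI[OF F(2) tendsto_const])
       (use F(1) in \<open>auto elim!: eventually_mono intro!: less_imp_le[OF one_minus_square_pos, simplified]\<close>)
  have "((\<lambda>x::real. 1 - x\<^sup>2) \<longlongrightarrow> 0) (at_left 1)" "((\<lambda>x::real. 1 - x\<^sup>2) \<longlongrightarrow> 0) (at_right (-1))"
    by (auto intro!: tendsto_eq_intros)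
  from lim[OF ev(1) this(1)] lim[OF ev(2) this(2)] show ?thesis
    unfolding lim_ends_zero_def using ev b
    by (auto intro!: Lim_null_comparison[where g = "\<lambda>x. K * (1 - x\<^sup>2) powr (3/4)"] elim: eventually_mono)
qed

lemma DERIV_arcsin_powr:
  assumes x: "x \<in> Iop"
  shows "(arcsin has_real_derivative (1 - x\<^sup>2) powr (-1/2)) (at x)"
proof -
  have "(1 - x\<^sup>2) powr (-1/2) = inverse (sqrt (1 - x\<^sup>2))"
    using one_minus_square_pos[OF x] powr_minus[of "1 - x\<^sup>2" "1/2"] by (simp add: powr_half_sqrt)
  then show ?thesis using DERIV_arcsin[of x] x by simp
qed

text \<open>The square of \<open>norm (h x)\<close> is dominated by a multiple of the derivative of
  \<open>arcsin\<close>, whose integral over the interval is finite by the fundamental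
  theorem.\<close>

lemma growth_L2:
  assumes cont: "continuous_on Iop h"
    and h: "\<And>x. x \<in> Iop \<Longrightarrow> norm (h x) \<le> K * (1 - x\<^sup>2) powr (-1/4)"
  shows "h \<in> L2"
proof -
  let ?w = "\<lambda>x::real. (1 - x\<^sup>2) powr (-1/2)"
  have m: "h \<in> borel_measurable (lebesgue_on Iop)"
    using cont by (intro continuous_imp_measurable_on_sets_lebesgue) auto
  have "(?w has_integral (arcsin 1 - arcsin (-1))) {-1..1}"
    by (rule fundamental_theorem_of_calculus_interior)
       (use DERIV_arcsin_powr in \<open>auto intro: continuous_on_arcsin' simp flip: has_real_derivative_iff_has_vector_derivative\<close>)
  then have "?w integrable_on {-1..1}" by blast
  then have "?w absolutely_integrable_on {-1..1}" by (intro nonnegative_absolutely_integrable_1) auto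
  then have "?w absolutely_integrable_on Iop" by (rule set_integrable_subset) auto
  then have "integrable (lebesgue_on Iop) ?w"
    by (simp add: absolutely_integrable_imp_integrable)
  then have "integrable (lebesgue_on Iop) (\<lambda>x. K\<^sup>2 * ?w x)" by simp
  then have "integrable (lebesgue_on Iop) (\<lambda>x. (norm (h x))\<^sup>2)"
  proof (rule Bochner_Integration.integrable_bound)
    show "(\<lambda>x. (norm (h x))\<^sup>2) \<in> borel_measurable (lebesgue_on Iop)" using m by measurable
    show "AE x in lebesgue_on Iop. norm ((norm (h x))\<^sup>2) \<le> norm (K\<^sup>2 * ?w x)"
    proof (rule AE_I2)
      fix x assume "x \<in> space (lebesgue_on Iop)"
      then have x: "x \<in> Iop" by simp
      have "(norm (h x))\<^sup>2 \<le> (K * (1 - x\<^sup>2) powr (-1/4))\<^sup>2" using h[OF x] by (intro power_mono) auto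
      also have "\<dots> = K\<^sup>2 * ?w x"
        using one_minus_square_pos[OF x] by (simp add: power_mult_distrib powr_power)
      finally show "norm ((norm (h x))\<^sup>2) \<le> norm (K\<^sup>2 * ?w x)" by simp
    qed
  qed
  then show ?thesis using m by (simp add: L2_def)
qed

text \<open>Weakening the exponent -1/4 to -1/2 makes the bounded function \<open>arcsin\<close>
  available as a majorising primitive.\<close>

lemma growth_primitive_bounded:
  fixes W h :: "real \<Rightarrow> complex"
  assumes W: "\<And>x. x \<in> Iop \<Longrightarrow> (W has_vector_derivative h x) (at x)"
    and h: "\<And>x. x \<in> Iop \<Longrightarrow> norm (h x) \<le> K * (1 - x\<^sup>2) powr (-1/4)" and "K \<ge> 0"
    and x: "x \<in> Iop"
  shows "norm (W x) \<le> norm (W 0) + K * (pi / 2)"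
proof -
  have "norm (W x - W 0) \<le> \<bar>K * arcsin x - K * arcsin 0\<bar>"
  proof (rule norm_diff_origin_le[OF W _ _ x])
    fix y assume y: "y \<in> Iop"
    show "((\<lambda>x. K * arcsin x) has_real_derivative K * (1 - y\<^sup>2) powr (-1/2)) (at y)"
      by (rule DERIV_cmult[OF DERIV_arcsin_powr[OF y]])
    have "(1 - y\<^sup>2) powr (-1/4) \<le> (1 - y\<^sup>2) powr (-1/2)"
      using one_minus_square_pos[OF y] by (intro powr_mono') auto
    then show "norm (h y) \<le> K * (1 - y\<^sup>2) powr (-1/2)"
      using h[OF y] \<open>K \<ge> 0\<close> by (meson mult_left_mono order_trans)
  qed
  also have "\<dots> = K * \<bar>arcsin x\<bar>" using \<open>K \<ge> 0\<close> by (simp add: abs_mult)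
  also have "\<dots> \<le> K * (pi / 2)" using arcsin_bounded[of x] x \<open>K \<ge> 0\<close> by (intro mult_left_mono) auto
  finally show ?thesis using norm_triangle_sub[of "W x" "W 0"] by simp
qed

section \<open>The square of the Legendre operator\<close>

text \<open>The derivatives are parameters so that one inclusion can supply iterates of
  \<open>D\<close> and the other explicit functions built from a representative of
  \<open>A f\<close>.\<close>

locale legendre_derivatives =
  fixes f f1 f2 f3 :: "real \<Rightarrow> complex"
  assumes f: "\<And>x. x \<in> Iop \<Longrightarrow> (f has_vector_derivative f1 x) (at x)"
    and f1: "\<And>x. x \<in> Iop \<Longrightarrow> (f1 has_vector_derivative f2 x) (at x)"
    and f2: "\<And>x. x \<in> Iop \<Longrightarrow> (f2 has_vector_derivative f3 x) (at x)"
    and f3: "f3 \<in> AC_loc"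
begin

text \<open>This is \<open>\<ell>[f]\<close> with the product rule carried out, hence free of
  \<open>D\<close>; \<open>h1\<close> below is its derivative, expanded likewise.\<close>

definition h :: "real \<Rightarrow> complex" where
  "h x = (2 * x) *\<^sub>R f1 x - (1 - x\<^sup>2) *\<^sub>R f2 x"

definition h1 :: "real \<Rightarrow> complex" where
  "h1 x = 2 *\<^sub>R f1 x + (4 * x) *\<^sub>R f2 x - (1 - x\<^sup>2) *\<^sub>R f3 x"

lemma D_f: "x \<in> Iop \<Longrightarrow> D f x = f1 x" and D_f1: "x \<in> Iop \<Longrightarrow> D f1 x = f2 x"
  using f f1 by (auto intro!: D_eq)

lemma DD_f: "x \<in> Iop \<Longrightarrow> D (D f) x = f2 x"
  using D_cong[of x "D f" f1] D_f D_f1 by auto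

lemma f_AC: "f2 \<in> AC_loc" "f1 \<in> AC_loc" "f \<in> AC_loc"
proof -
  show 2: "f2 \<in> AC_loc" by (rule AC_loc_C1[OF f2 AC_loc_continuous[OF f3]])
  show 1: "f1 \<in> AC_loc" by (rule AC_loc_C1[OF f1 AC_loc_continuous[OF 2]])
  show "f \<in> AC_loc" by (rule AC_loc_C1[OF f AC_loc_continuous[OF 1]])
qed

lemma deriv_pf1:
  assumes "x \<in> Iop"
  shows "((\<lambda>x. (1 - x\<^sup>2) *\<^sub>R f1 x) has_vector_derivative - h x) (at x)"
proof -
  have "((\<lambda>x. 1 - x\<^sup>2) has_real_derivative - (2 * x)) (at x)"
    by (auto intro!: derivative_eq_intros)
  from has_vector_derivative_scaleR[OF this f1[OF assms]] show ?thesis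
    by (simp add: h_def)
qed

lemma deriv_h:
  assumes "x \<in> Iop"
  shows "(h has_vector_derivative h1 x) (at x)"
proof -
  have "((\<lambda>x. 2 * x) has_real_derivative 2) (at x)" "((\<lambda>x. 1 - x\<^sup>2) has_real_derivative - (2 * x)) (at x)"
    by (auto intro!: derivative_eq_intros)
  from has_vector_derivative_diff[OF has_vector_derivative_scaleR[OF this(1) f1[OF assms]]
      has_vector_derivative_scaleR[OF this(2) f2[OF assms]]]
  have "(h has_vector_derivative (2 * x) *\<^sub>R f2 x + 2 *\<^sub>R f1 x -
     ((1 - x\<^sup>2) *\<^sub>R f3 x + (- (2 * x)) *\<^sub>R f2 x)) (at x)"
    unfolding h_def[abs_def] .
  then show ?thesis
    by (rule back_subst[of "\<lambda>d. (h has_vector_derivative d) (at x)"])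
      (simp add: h1_def scaleR_conv_of_real algebra_simps)
qed

lemma D_h: "x \<in> Iop \<Longrightarrow> D h x = h1 x"
  by (rule D_eq[OF deriv_h])

text \<open>With \<open>p = 1 - x\<^sup>2\<close> this is
  \<open>(p\<^sup>2 f'')' = 2 p f' - p h'\<close>. Its first term cancels against
  \<open>- 2 p f'\<close> in the form with 1, which leaves \<open>- p h'\<close>.\<close>

lemma deriv_p2f2:
  assumes "x \<in> Iop"
  shows "((\<lambda>x. (1 - x\<^sup>2)\<^sup>2 *\<^sub>R f2 x) has_vector_derivative
    (2 * (1 - x\<^sup>2)) *\<^sub>R f1 x - (1 - x\<^sup>2) *\<^sub>R h1 x) (at x)"
proof -
  have "((\<lambda>x. (1 - x\<^sup>2)\<^sup>2) has_real_derivative - (4 * x * (1 - x\<^sup>2))) (at x)"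
    by (auto intro!: derivative_eq_intros)
  from has_vector_derivative_scaleR[OF this f2[OF assms]] show ?thesis
    by (rule back_subst[of "\<lambda>d. (_ has_vector_derivative d) (at x)"])
      (simp add: h1_def scaleR_conv_of_real power2_eq_square algebra_simps)
qed

lemma legendre_f:
  assumes x: "x \<in> Iop"
  shows "legendre f x = h x"
proof -
  have "D (\<lambda>t. (1 - t\<^sup>2) *\<^sub>R D f t) x = D (\<lambda>t. (1 - t\<^sup>2) *\<^sub>R f1 t) x"
    using x by (rule D_cong) (simp add: D_f)
  then show ?thesis by (simp add: legendre_def D_eq[OF deriv_pf1[OF x]])
qed

lemma D_p2f2:
  assumes x: "x \<in> Iop"
  shows "D (\<lambda>t. (1 - t\<^sup>2)\<^sup>2 *\<^sub>R D (D f) t) x = (2 * (1 - x\<^sup>2)) *\<^sub>R f1 x - (1 - x\<^sup>2) *\<^sub>R h1 x"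
proof -
  have "D (\<lambda>t. (1 - t\<^sup>2)\<^sup>2 *\<^sub>R D (D f) t) x = D (\<lambda>t. (1 - t\<^sup>2)\<^sup>2 *\<^sub>R f2 t) x"
    using x by (rule D_cong) (simp add: DD_f)
  then show ?thesis by (simp add: D_eq[OF deriv_p2f2[OF x]])
qed

lemma form2_f_one:
  assumes "x \<in> Iop"
  shows "form2 f (\<lambda>x. 1) x = - ((1 - x\<^sup>2) *\<^sub>R h1 x)"
  unfolding form2_one D_p2f2[OF assms] D_f[OF assms]
  by (simp add: scaleR_conv_of_real)

text \<open>The second derivative is eliminated by \<open>- p f'' = h - 2 x f'\<close>, leaving only
  terms whose behaviour at the ends can be controlled.\<close>

lemma form2_f_id:
  assumes "x \<in> Iop"
  shows "form2 f complex_of_real x = (- x) *\<^sub>R ((1 - x\<^sup>2) *\<^sub>R h1 x) + (1 - x\<^sup>2) *\<^sub>R h x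
      + 2 *\<^sub>R ((1 - x\<^sup>2) *\<^sub>R f x) + (- 2 * x) *\<^sub>R ((1 - x\<^sup>2) *\<^sub>R f1 x)"
  unfolding form2_id form2_f_one[OF assms] DD_f[OF assms] h_def
  by (simp add: algebra_simps scaleR_conv_of_real power2_eq_square)

lemma h1_AC: "h1 \<in> AC_loc"
  unfolding h1_def[abs_def]
  by (intro AC_loc_diff AC_loc_add AC_loc_scaleR_C1[of "\<lambda>x. 2" "\<lambda>x. 0"]
      AC_loc_scaleR_C1[of "\<lambda>x. 4 * x" "\<lambda>x. 4"] AC_loc_scaleR_C1[of "\<lambda>x. 1 - x\<^sup>2" "\<lambda>x. - 2 * x"] f_AC f3)
    (auto intro!: derivative_eq_intros continuous_intros)

text \<open>Where \<open>p h'\<close> is differentiable, \<open>(p\<^sup>2 f'')''\<close> equals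
  \<open>- 2 h - (p h')'\<close>, and subtracting \<open>2 (p f')'\<close> adds \<open>2 h\<close>
  back.\<close>

lemma legendre_sq_f:
  assumes x: "x \<in> Iop" and diff: "(\<lambda>t. (1 - t\<^sup>2) *\<^sub>R h1 t) differentiable (at x)"
  shows "legendre_sq f x = legendre h x"
proof -
  let ?w = "\<lambda>t. (1 - t\<^sup>2) *\<^sub>R h1 t"
  have w: "(?w has_vector_derivative D ?w x) (at x)" using diff by (rule differentiable_D)
  have "D (D (\<lambda>t. (1 - t\<^sup>2)\<^sup>2 *\<^sub>R D (D f) t)) x = D (\<lambda>x. 2 *\<^sub>R ((1 - x\<^sup>2) *\<^sub>R f1 x) - ?w x) x"
    using x by (rule D_cong) (simp add: D_p2f2)
  also have "\<dots> = 2 *\<^sub>R (- h x) - D ?w x"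
    by (intro D_eq has_vector_derivative_diff w deriv_pf1 x
        bounded_linear.has_vector_derivative[OF bounded_linear_scaleR_right])
  finally have 1: "D (D (\<lambda>t. (1 - t\<^sup>2)\<^sup>2 *\<^sub>R D (D f) t)) x = 2 *\<^sub>R (- h x) - D ?w x" .
  have 2: "D (\<lambda>t. (1 - t\<^sup>2) *\<^sub>R D f t) x = - h x"
    using legendre_f[OF x] unfolding legendre_def by (metis minus_minus)
  have 3: "legendre h x = - D ?w x"
    unfolding legendre_def using x by (subst D_cong[of x _ ?w]) (auto simp: D_h)
  show ?thesis unfolding legendre_sq_def 1 2 3 by (simp add: scaleR_conv_of_real)
qed

text \<open>Both sides contain a junk value of \<^const>\<open>D\<close> wherever \<open>(1 - x\<^sup>2) h'\<close> fails to be
  differentiable, so they need not agree everywhere.\<close>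

lemma legendre_sq_f_ae: "AE x in lebesgue_on Iop. legendre_sq f x = legendre h x"
proof (rule AE_Iop_negligible, rule negligible_subset)
  have "(\<lambda>t. (1 - t\<^sup>2) *\<^sub>R h1 t) \<in> AC_loc"
    by (rule AC_loc_scaleR_C1[of _ "\<lambda>x. - 2 * x"])
       (auto intro!: derivative_eq_intros continuous_intros h1_AC)
  then show "negligible {x \<in> Iop. \<not> (\<lambda>t. (1 - t\<^sup>2) *\<^sub>R h1 t) differentiable (at x)}"
    by (rule AC_loc_differentiable_ae)
qed (use legendre_sq_f in auto)

lemma f_upto_3: "f \<in> AC_loc_upto 3"
  unfolding AC_loc_upto_3
proof (intro conjI ballI)
  have DDD: "D (D (D f)) x = f3 x" if "x \<in> Iop" for x
    using that D_cong[of x "D (D f)" f2] DD_f f2[THEN D_eq] by auto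
  fix x assume x: "x \<in> Iop"
  show "(f has_vector_derivative D f x) (at x)" using f D_f x by simp
  show "(D f has_vector_derivative D (D f) x) (at x)"
    unfolding DD_f[OF x] using has_vector_derivative_cong_Iop[OF x, of "D f" f1] D_f f1[OF x] by blast
  show "(D (D f) has_vector_derivative D (D (D f)) x) (at x)"
    unfolding DDD[OF x] using has_vector_derivative_cong_Iop[OF x, of "D (D f)" f2] DD_f f2[OF x] by blast
next
  show "D (D (D f)) \<in> AC_loc"
    by (rule AC_loc_cong[OF _ f3]) (use D_cong[of _ "D (D f)" f2] DD_f f2[THEN D_eq] in auto)
qed

lemma f_AC_upto_1: "f \<in> AC_loc_upto 1"
  unfolding AC_loc_upto_1
  using f D_f AC_loc_cong[OF _ f_AC(2), of "D f"] by simp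

text \<open>\<open>growth_bound\<close> is applied twice: to \<open>h\<close>, and then to
  \<open>f\<close>, once \<open>p f'\<close> is known to be bounded as a primitive of
  \<open>- h\<close>.\<close>

lemma end_behaviour_of_lim_ends_zero:
  assumes "lim_ends_zero (\<lambda>x. (1 - x\<^sup>2) *\<^sub>R h1 x)"
  shows "h \<in> L2" "lim_ends_zero (\<lambda>x. (1 - x\<^sup>2) *\<^sub>R h x)" "lim_ends_zero (\<lambda>x. (1 - x\<^sup>2) *\<^sub>R f x)"
proof -
  have "continuous_on Iop (\<lambda>x. (1 - x\<^sup>2) *\<^sub>R h1 x)"
    by (intro continuous_intros AC_loc_continuous h1_AC)
  from lim_ends_zero_bounded[OF assms this]
  obtain C where "\<And>x. x \<in> Iop \<Longrightarrow> norm ((1 - x\<^sup>2) *\<^sub>R h1 x) \<le> C"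
    by blast
  from growth_bound[OF deriv_h this]
  obtain K where K: "K \<ge> 0" "\<And>x. x \<in> Iop \<Longrightarrow> norm (h x) \<le> K * (1 - x\<^sup>2) powr (-1/4)"
    by blast
  have "continuous_on Iop h"
    using has_vector_derivative_continuous[OF deriv_h] by (intro continuous_at_imp_continuous_on ballI)
  then have hL2: "h \<in> L2" using K(2) by (rule growth_L2)
  have "norm ((1 - x\<^sup>2) *\<^sub>R f1 x) \<le> norm ((1 - 0\<^sup>2) *\<^sub>R f1 0) + K * (pi / 2)" if "x \<in> Iop" for x
    using growth_primitive_bounded[OF deriv_pf1 _ K(1) that] K(2) by simp
  from growth_bound[OF f this]
  obtain L where L: "\<And>x. x \<in> Iop \<Longrightarrow> norm (f x) \<le> L * (1 - x\<^sup>2) powr (-1/4)"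
    by blast
  show "h \<in> L2" "lim_ends_zero (\<lambda>x. (1 - x\<^sup>2) *\<^sub>R h x)" "lim_ends_zero (\<lambda>x. (1 - x\<^sup>2) *\<^sub>R f x)"
    by (rule hL2 growth_lim_ends_zero[OF K(2)] growth_lim_ends_zero[OF L], assumption?)+
qed

end

section \<open>The boundary conditions of \<open>dom_S\<close> imply those of
  \<open>dom_A2\<close>\<close>

lemma dom_S_subset: "dom_S \<subseteq> dom_A2"
proof
  fix f assume "f \<in> dom_S"
  then have ext: "f \<in> extensional Iop" and up: "f \<in> AC_loc_upto 3" and fL2: "f \<in> L2"
    and sqL2: "legendre_sq f \<in> L2" and one: "lim_ends_zero (form2 f (\<lambda>x. 1))"
    and id: "lim_ends_zero (form2 f complex_of_real)"
    by (auto simp: dom_S_def)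
  interpret legendre_derivatives f "D f" "D (D f)" "D (D (D f))"
    using up unfolding AC_loc_upto_3 by unfold_locales auto
  let ?p = "\<lambda>x::real. 1 - x\<^sup>2"
  have ph1: "lim_ends_zero (\<lambda>x. ?p x *\<^sub>R h1 x)"
    by (rule lim_ends_zero_cong[OF lim_ends_zero_scaleR[OF one tendsto_const[of "-1"] tendsto_const]])
      (simp add: form2_f_one scaleR_left_diff_distrib)
  have hL2: "h \<in> L2" and ph: "lim_ends_zero (\<lambda>x. ?p x *\<^sub>R h x)" 
    and pf: "lim_ends_zero (\<lambda>x. ?p x *\<^sub>R f x)"
    using end_behaviour_of_lim_ends_zero[OF ph1] by simp_all
  \<comment> \<open>The added terms cancel everything in \<open>form2_f_id\<close> except
    \<open>- 2 x p f'\<close>.\<close>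
  have "lim_ends_zero (\<lambda>x. form2 f complex_of_real x + x *\<^sub>R (?p x *\<^sub>R h1 x) + (-1) *\<^sub>R (?p x *\<^sub>R h x)
     + (-2) *\<^sub>R (?p x *\<^sub>R f x))"
    by (intro lim_ends_zero_add id lim_ends_zero_scaleR[OF ph1] lim_ends_zero_scaleR[OF ph] lim_ends_zero_scaleR[OF pf])
      (rule tendsto_intros)+
  then have "lim_ends_zero (\<lambda>x. (- 2 * x) *\<^sub>R (?p x *\<^sub>R D f x))"
    by (rule lim_ends_zero_cong) (simp add: form2_f_id scaleR_conv_of_real algebra_simps)
  \<comment> \<open>The factor has the finite limits -1/2 and 1/2 at the two ends; its value at 0
    does not affect the limits.\<close>
  then have "lim_ends_zero (\<lambda>x. (1 / (- 2 * x)) *\<^sub>R ((- 2 * x) *\<^sub>R (?p x *\<^sub>R D f x)))"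
    by (rule lim_ends_zero_scaleR) (rule tendsto_intros | simp)+
  then have pf1: "lim_ends_zero (\<lambda>x. ?p x *\<^sub>R D f x)"
    by (rule lim_ends_zero_cong) (simp add: scaleR_left_diff_distrib)
  have leg: "legendre f \<in> L2"
    by (rule L2_cong_AE[OF hL2 AE_I2]) (simp add: legendre_f)
  \<comment> \<open>\<open>dom_A\<close> contains only functions that are \<open>undefined\<close>
    outside the interval. Restriction leaves \<open>D\<close> unchanged inside, because the interval
    is open.\<close>
  define g where "g = restrict h Iop"
  have g: "g x = h x" if "x \<in> Iop" for x using that by (simp add: g_def)
  have Dg: "D g x = h1 x" if "x \<in> Iop" for x
    using D_cong[of x g h] that D_h by (simp add: g_def)
  have lg: "legendre g x = legendre h x" if "x \<in> Iop" for x
    unfolding legendre_def using that D_cong[of x "\<lambda>t. ?p t *\<^sub>R D g t" "\<lambda>t. ?p t *\<^sub>R D h t"] Dg D_h by simp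
  have "g \<in> dom_A"
    unfolding dom_A_def
  proof (intro CollectI conjI)
    show "g \<in> extensional Iop" by (simp add: g_def)
    show "g \<in> AC_loc_upto 1"
      unfolding AC_loc_upto_1
      using Dg has_vector_derivative_cong_Iop[of _ g h] g deriv_h AC_loc_cong[OF _ h1_AC, of "D g"] by simp
    show "g \<in> L2" by (rule L2_cong_AE[OF hL2 AE_I2]) (simp add: g)
    show "legendre g \<in> L2"
      by (rule L2_cong_AE[OF sqL2 AE_mp[OF legendre_sq_f_ae AE_I2]]) (simp add: lg)
    show "lim_ends_zero (\<lambda>x. ?p x *\<^sub>R D g x)"
      by (rule lim_ends_zero_cong[OF ph1]) (simp add: Dg)
  qed
  moreover have "f \<in> dom_A" 
    using ext f_AC_upto_1 fL2 leg pf1 by (simp add: dom_A_def)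
  moreover have "AE x in lebesgue_on Iop. g x = legendre f x"
    by (rule AE_I2) (simp add: g legendre_f)
  ultimately show "f \<in> dom_A2" by (auto simp: dom_A2_def)
qed

section \<open>Gain of regularity and the reverse inclusion\<close>

text \<open>On a compact neighbourhood of \<open>x\<close>, \<open>W\<close> is compared with an
  antiderivative \<open>G\<close> of \<open>k\<close>: the difference is absolutely continuous with
  derivative 0 almost everywhere, hence constant.\<close>

lemma AC_loc_ae_derivative_continuous:
  assumes W: "W \<in> AC_loc" and k: "continuous_on Iop k" and ae: "AE x in lebesgue_on Iop. D W x = k x"
    and x: "x \<in> Iop"
  shows "(W has_vector_derivative k x) (at x)"
proof -
  define a where "a = (x - 1) / 2"
  define b where "b = (x + 1) / 2"
  have ab: "-1 < a" "a < x" "x < b" "b < 1" using x by (auto simp: a_def b_def)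
  have k': "continuous_on {a..b} k" using ab by (intro continuous_on_subset[OF k]) auto
  obtain G where G: "\<And>y. y \<in> {a..b} \<Longrightarrow> (G has_vector_derivative k y) (at y within {a..b})"
    using antiderivative_continuous[OF k'] by blast
  \<comment> \<open>Points without derivative are removed separately, since there \<open>D W\<close>
    is a default value that could equal \<open>k\<close> by accident. At \<open>a\<close> and
    \<open>b\<close> the function \<open>G\<close> has only a one-sided derivative.\<close>
  define N where "N = {y \<in> Iop. \<not> W differentiable (at y)} \<union> {y \<in> Iop. D W y \<noteq> k y} \<union> {a, b}"
  have "AE y in lebesgue. y \<in> Iop \<longrightarrow> D W y = k y"
    using ae by (subst (asm) AE_restrict_space_iff) auto
  then have "{y \<in> Iop. D W y \<noteq> k y} \<in> null_sets lebesgue"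
    by (simp add: completion.AE_iff_null_sets)
  then have N: "negligible N"
    unfolding N_def using AC_loc_differentiable_ae[OF W] 
    by (intro negligible_Un) (auto simp: negligible_iff_null_sets[symmetric])
  have const: "W y - G y = W a - G a" if y: "y \<in> {a..b}" for y
  proof (rule abs_cont_on_zero_derivative[OF _ _ N])
    have "abs_cont_on a y W" using W y ab by (auto simp: AC_loc_def)
    moreover have "abs_cont_on a y (\<lambda>y. - G y)"
      using y by (intro abs_cont_on_C1[of _ _ _ "\<lambda>y. - k y"])
        (auto intro!: has_vector_derivative_minus has_vector_derivative_within_subset[OF G] continuous_on_minus continuous_on_subset[OF k'])
    ultimately show "abs_cont_on a y (\<lambda>y. W y - G y)"
      using abs_cont_on_add by fastforce
    show "a \<le> y" using y by simp
    fix z assume z: "z \<in> {a..y} - N"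
    then have zab: "z \<in> {a<..<b}" "z \<in> Iop" using y ab by (auto simp: N_def)
    then have "W differentiable (at z)" "D W z = k z" using z by (auto simp: N_def)
    then have "(W has_vector_derivative k z) (at z)" using differentiable_D by metis
    moreover have "(G has_vector_derivative k z) (at z)"
      using G[of z] zab by (simp add: at_within_Icc_at)
    ultimately have "((\<lambda>y. W y - G y) has_vector_derivative k z - k z) (at z)"
      by (rule has_vector_derivative_diff)
    then show "((\<lambda>y. W y - G y) has_vector_derivative 0) (at z within {a..y})"
      by (simp add: has_vector_derivative_at_within)
  qed
  have "(G has_vector_derivative k x) (at x)"
    using G[of x] ab by (simp add: at_within_Icc_at)
  then have "((\<lambda>y. G y + (W a - G a)) has_vector_derivative k x) (at x)"
    by (auto intro!: derivative_eq_intros)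
  then show ?thesis
  proof (rule has_vector_derivative_transform_within_open[where S = "{a<..<b}"])
    show "G y + (W a - G a) = W y" if "y \<in> {a<..<b}" for y
      using const[of y] that by (simp add: algebra_simps)
  qed (use ab in auto)
qed

lemma dom_A2_subset: "dom_A2 \<subseteq> dom_S"
proof
  fix f assume "f \<in> dom_A2"
  then obtain g where fA: "f \<in> dom_A" and gA: "g \<in> dom_A" and fg: "AE x in lebesgue_on Iop. g x = legendre f x"
    by (auto simp: dom_A2_def)
  let ?p = "\<lambda>x::real. 1 - x\<^sup>2"
  let ?W = "\<lambda>x. ?p x *\<^sub>R D f x"
  have f: "\<And>x. x \<in> Iop \<Longrightarrow> (f has_vector_derivative D f x) (at x)" and f1: "D f \<in> AC_loc"
    using fA unfolding dom_A_def AC_loc_upto_1 by auto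
  have g: "\<And>x. x \<in> Iop \<Longrightarrow> (g has_vector_derivative D g x) (at x)" and g1: "D g \<in> AC_loc"
    using gA unfolding dom_A_def AC_loc_upto_1 by auto
  have gAC: "g \<in> AC_loc" by (rule AC_loc_C1[OF g AC_loc_continuous[OF g1]])
  have W: "?W \<in> AC_loc"
    by (rule AC_loc_scaleR_C1[of _ "\<lambda>x. - 2 * x"]) (auto intro!: derivative_eq_intros continuous_intros f1)
  \<comment> \<open>The equation defining \<open>A f\<close>, known almost everywhere, now holds at
    every point because its right-hand side is continuous.\<close>
  have dW: "(?W has_vector_derivative - g x) (at x)" if "x \<in> Iop" for x
  proof (rule AC_loc_ae_derivative_continuous[OF W _ _ that])
    show "continuous_on Iop (\<lambda>x. - g x)" using gAC by (intro continuous_on_minus AC_loc_continuous)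
    show "AE x in lebesgue_on Iop. D ?W x = - g x"
      using fg by (rule AE_mp) (simp add: legendre_def)
  qed
  \<comment> \<open>Solving \<open>(p f')' = - g\<close> for \<open>f''\<close> gives
    \<open>f2\<close>; solving the differentiated equation for \<open>f'''\<close> gives
    \<open>f3\<close>.\<close>
  define f2 where "f2 x = (1 / ?p x) *\<^sub>R ((2 * x) *\<^sub>R D f x - g x)" for x
  define f3 where "f3 x = (1 / ?p x) *\<^sub>R (2 *\<^sub>R D f x + (4 * x) *\<^sub>R f2 x - D g x)" for x
  have q: "((\<lambda>x. 1 / ?p x) has_real_derivative 2 * x / (?p x)\<^sup>2) (at x)" if "x \<in> Iop" for x
    using one_minus_square_pos[OF that] by (auto intro!: derivative_eq_intros simp: power2_eq_square)
  have qc: "continuous_on Iop (\<lambda>x. 2 * x / (?p x)\<^sup>2)"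
    using one_minus_square_pos by (intro continuous_intros) force
  have df1: "(D f has_vector_derivative f2 x) (at x)" if x: "x \<in> Iop" for x
  proof -
    have "((\<lambda>x. (1 / ?p x) *\<^sub>R ?W x) has_vector_derivative 
       (1 / ?p x) *\<^sub>R (- g x) + (2 * x / (?p x)\<^sup>2) *\<^sub>R ?W x) (at x)"
      by (rule has_vector_derivative_scaleR[OF q[OF x] dW[OF x]])
    also have "(2 * x / (?p x)\<^sup>2) *\<^sub>R ?W x = (1 / ?p x) *\<^sub>R ((2 * x) *\<^sub>R D f x)"
      using one_minus_square_pos[OF x] by (simp add: power2_eq_square)
    also have "(1 / ?p x) *\<^sub>R (- g x) + (1 / ?p x) *\<^sub>R ((2 * x) *\<^sub>R D f x) = f2 x"
      by (simp add: f2_def scaleR_right_diff_distrib)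
    finally show ?thesis
      using one_minus_square_pos by (subst has_vector_derivative_cong_Iop[OF x, of _ "\<lambda>x. (1 / ?p x) *\<^sub>R ?W x"]) force+
  qed
  have df2: "(f2 has_vector_derivative f3 x) (at x)" if x: "x \<in> Iop" for x
  proof -
    have "((\<lambda>x. (2 * x) *\<^sub>R D f x - g x) has_vector_derivative ((2 * x) *\<^sub>R f2 x + 2 *\<^sub>R D f x - D g x)) (at x)"
      using has_vector_derivative_scaleR[OF _ df1[OF x], of "\<lambda>x. 2 * x" 2]
      by (intro has_vector_derivative_diff g[OF x]) (auto intro!: derivative_eq_intros)
    from has_vector_derivative_scaleR[OF q[OF x] this]
    have "(f2 has_vector_derivative (1 / ?p x) *\<^sub>R ((2 * x) *\<^sub>R f2 x + 2 *\<^sub>R D f x - D g x)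
        + (2 * x / (?p x)\<^sup>2) *\<^sub>R ((2 * x) *\<^sub>R D f x - g x)) (at x)"
      unfolding f2_def[abs_def] .
    \<comment> \<open>Differentiating \<open>1 / p\<close> reproduces \<open>f2\<close>, so the
      coefficient of \<open>f2\<close> becomes \<open>4 x\<close> in total.\<close>
    also have "(2 * x / (?p x)\<^sup>2) *\<^sub>R ((2 * x) *\<^sub>R D f x - g x) = (1 / ?p x) *\<^sub>R ((2 * x) *\<^sub>R f2 x)"
      by (simp add: f2_def power2_eq_square)
    finally have "(f2 has_vector_derivative (1 / ?p x) *\<^sub>R
        ((2 * x) *\<^sub>R f2 x + 2 *\<^sub>R D f x - D g x + (2 * x) *\<^sub>R f2 x)) (at x)"
      unfolding scaleR_right_distrib .
    also have "(2 * x) *\<^sub>R f2 x + 2 *\<^sub>R D f x - D g x + (2 * x) *\<^sub>R f2 x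
        = 2 *\<^sub>R D f x + (4 * x) *\<^sub>R f2 x - D g x"
      by (simp add: scaleR_conv_of_real algebra_simps)
    finally show ?thesis by (simp only: f3_def)
  qed
  have f2AC: "f2 \<in> AC_loc"
    unfolding f2_def[abs_def]
    by (intro AC_loc_scaleR_C1[OF q qc] AC_loc_diff gAC AC_loc_scaleR_C1[OF _ _ f1, of "\<lambda>x. 2 * x" "\<lambda>_. 2"])
      (auto intro!: derivative_eq_intros)
  have f3AC: "f3 \<in> AC_loc"
    unfolding f3_def[abs_def]
    by (intro AC_loc_scaleR_C1[OF q qc] AC_loc_diff AC_loc_add g1 
        AC_loc_scaleR_C1[OF _ _ f1, of "\<lambda>x. 2" "\<lambda>_. 0"] AC_loc_scaleR_C1[OF _ _ f2AC, of "\<lambda>x. 4 * x" "\<lambda>_. 4"])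
      (auto intro!: derivative_eq_intros)
  interpret legendre_derivatives f "D f" f2 f3
    by (rule legendre_derivatives.intro[OF f df1 df2 f3AC])
  \<comment> \<open>By the choice of \<open>f2\<close>, the locale function \<open>h\<close> is the
    given representative of \<open>A f\<close>, so the conditions on \<open>g\<close> become
    conditions on \<open>h\<close>.\<close>
  have hg: "h x = g x" if "x \<in> Iop" for x
    using one_minus_square_pos[OF that] by (simp add: h_def f2_def)
  have h1g: "h1 x = D g x" if "x \<in> Iop" for x
    using D_h[OF that] D_cong[OF that, of h g] hg by simp
  have "lim_ends_zero (\<lambda>x. ?p x *\<^sub>R D g x)" using gA by (simp add: dom_A_def)
  then have ph1: "lim_ends_zero (\<lambda>x. ?p x *\<^sub>R h1 x)"
    by (rule lim_ends_zero_cong) (simp add: h1g)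
  have ph: "lim_ends_zero (\<lambda>x. ?p x *\<^sub>R h x)" and pf: "lim_ends_zero (\<lambda>x. ?p x *\<^sub>R f x)"
    using end_behaviour_of_lim_ends_zero[OF ph1] by simp_all
  have pf1: "lim_ends_zero ?W" using fA by (simp add: dom_A_def)
  have one: "lim_ends_zero (form2 f (\<lambda>x. 1))"
    by (rule lim_ends_zero_cong[OF lim_ends_zero_scaleR[OF ph1 tendsto_const[of "-1"] tendsto_const]])
      (simp add: form2_f_one scaleR_left_diff_distrib)
  have "lim_ends_zero (\<lambda>x. (- x) *\<^sub>R (?p x *\<^sub>R h1 x) + ?p x *\<^sub>R h x
      + 2 *\<^sub>R (?p x *\<^sub>R f x) + (- 2 * x) *\<^sub>R ?W x)"
    by (intro lim_ends_zero_add lim_ends_zero_scaleR[OF ph1] ph lim_ends_zero_scaleR[OF pf] lim_ends_zero_scaleR[OF pf1])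
      (rule tendsto_intros)+
  then have id: "lim_ends_zero (form2 f complex_of_real)"
    by (rule lim_ends_zero_cong) (simp add: form2_f_id)
  have lg: "legendre g x = legendre h x" if "x \<in> Iop" for x
    unfolding legendre_def
    using that D_cong[of x "\<lambda>t. ?p t *\<^sub>R D g t" "\<lambda>t. ?p t *\<^sub>R D h t"] h1g D_h by simp
  \<comment> \<open>Square integrability of \<open>\<ell>\<^sup>2[f]\<close> is that of
    \<open>\<ell>[g]\<close>, the two being equal almost everywhere.\<close>
  have "legendre g \<in> L2" using gA by (simp add: dom_A_def)
  then have "legendre_sq f \<in> L2"
    by (rule L2_cong_AE[OF _ AE_mp[OF legendre_sq_f_ae AE_I2]]) (simp add: lg)
  then show "f \<in> dom_S"
    using fA f_upto_3 one id by (simp add: dom_S_def dom_A_def)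
qed

theorem theorem3:
  shows "dom_A2 = dom_S"
  using dom_A2_subset dom_S_subset by (rule subset_antisym)

end
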